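(* Let $\mathbb{R}_+=(0,\infty)$ and equip $\mathbb{R}_+^n$ with the restriction $D$ of the standard affine connection of $\mathbb{R}^n$ and the Riemannian metric $g_{ij}(x)=\frac{\delta_{ij}}{(x^j)^2}$. For $p\ge1$, $q\ge0$ and $v\in L^{p,q}(\mathbb{R}_+^n,g)$ such that $\bar\partial v=0$, there exists $u\in L^{p,q-1}(\mathbb{R}_+^n,g)$ such that $$\bar\partial u=v,\qquad\|u\|\le p^{-1/2}\|v\|.$$ In particular, $$L^2H^{p,q}_{\bar\partial}(\mathbb{R}_+^n,g)=0\quad\text{for } p\ge1\text{ and }q\ge0.$$
   Context: Write $M=\mathbb{R}_+^n$ with standard coordinates $x^i$. $A^{p,q}(M)$ is the space of smooth sections of $\wedge^pT^*M\otimes\wedge^qT^*M$, $A^{p,q}_0(M)$ the compactly supported ones; $\omega\otimes\bar\eta$ denotes the tensor product of a $p$-form and a $q$-form. $\bar\partial:A^{p,q}(M)\to A^{p,q+1}(M)$ is $\bar\partial(f\,dx^I\otimes\overline{dx^J})=\sum_i\frac{\partial f}{\partial x^i}dx^I\otimes\overline{dx^i\wedge dx^J}$. The inner product is $(\omega,\eta)=\int_M\langle\omega,\eta\rangle v_g$ (pointwise metric induced by $g$, $v_g$ the Riemannian volume form), $\|\omega\|=\sqrt{(\omega,\omega)}$, and $\bar\delta$ is the formal adjoint of $\bar\partial$. $L^{p,q}(M,g)$ is the completion of $A_0^{p,q}(M)$, i.e. the square-integrable sections; for $\omega\in L^{p,q}(M,g)$, $\bar\partial\omega$ is defined weakly by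 $(\bar\partial\omega,\eta)=(\omega,\bar\delta\eta)$ for all $\eta\in A_0^{p,q+1}(M)$. Let $D^{p,q}=\{\omega\in L^{p,q}(M,g)\mid\bar\partial\omega\in L^{p,q+1}(M,g)\}$ and $$L^2H^{p,q}_{\bar\partial}(M,g)=\frac{\mathrm{Ker}[\bar\partial:D^{p,q}\to D^{p,q+1}]}{\overline{\mathrm{Im}[\bar\partial:D^{p,q-1}\to D^{p,q}]}},$$ with closure in $\|\cdot\|$. Spaces of $(p,-1)$-forms are zero. *)

theory Defs
  imports "HOL-Analysis.Analysis" "HOL-Library.Function_Algebras"
begin

definition orthant :: "(real ^ 'n::finite) set" where
  "orthant = {x. \<forall>i. 0 < x $ i}"

text \<open>
  A section of \<open>\<Lambda>\<^sup>pT\<^sup>*M \<otimes> \<Lambda>\<^sup>qT\<^sup>*M\<close> over the orthant \<open>M\<close> is represented by its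
  coefficients \<open>\<omega> I J\<close> with respect to the global frame \<open>dx\<^sup>I \<otimes> dx\<^sup>J\<close>.  The multi-indices
  are the sets \<open>I\<close>, \<open>J\<close>, listed increasingly; the order on the index type is that of the
  coordinates.  Coefficients are \<open>0\<close> outside \<open>M\<close> and for index sets of the wrong size.
  The second degree is an integer, so that the space of \<open>(p,-1)\<close>-forms is \<open>{0}\<close>.
\<close>

type_synonym 'n form = "'n set \<Rightarrow> 'n set \<Rightarrow> real ^ 'n \<Rightarrow> real"

type_synonym 'n metric = "real ^ 'n \<Rightarrow> real ^ 'n ^ 'n"

definition forms :: "nat \<Rightarrow> int \<Rightarrow> ('n::finite) form set" where
  "forms p q =
     {\<omega>. \<forall>I J x. \<omega> I J x \<noteq> 0 \<longrightarrow> card I = p \<and> int (card J) = q \<and> x \<in> orthant}"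

definition pderiv_at :: "'n::finite \<Rightarrow> (real ^ 'n \<Rightarrow> real) \<Rightarrow> real ^ 'n \<Rightarrow> real" where
  "pderiv_at i f x = frechet_derivative f (at x) (axis i 1)"

text \<open>\<open>C\<^sup>k\<close> on an open set \<open>S\<close>.\<close>

primrec Ck_on :: "nat \<Rightarrow> (real ^ 'n::finite) set \<Rightarrow> (real ^ 'n \<Rightarrow> real) \<Rightarrow> bool" where
  "Ck_on 0 S f \<longleftrightarrow> continuous_on S f"
| "Ck_on (Suc k) S f \<longleftrightarrow> f differentiable_on S \<and> (\<forall>i. Ck_on k S (pderiv_at i f))"

definition smooth_forms :: "nat \<Rightarrow> int \<Rightarrow> ('n::finite) form set" where
  "smooth_forms p q = {\<omega> \<in> forms p q. \<forall>I J k. Ck_on k orthant (\<omega> I J)}"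

definition test_forms :: "nat \<Rightarrow> int \<Rightarrow> ('n::finite) form set" where
  "test_forms p q =
     {\<omega> \<in> smooth_forms p q.
        \<exists>K. compact K \<and> K \<subseteq> orthant \<and> (\<forall>I J x. x \<notin> K \<longrightarrow> \<omega> I J x = 0)}"

text \<open>
  \<open>dx\<^sup>i \<and> dx\<^sup>J = (-1)\<^sup>m dx\<^sup>K\<close> with \<open>K = J \<union> {i}\<close> and \<open>m\<close> the number of elements of \<open>J\<close>
  below \<open>i\<close>, if \<open>i \<notin> J\<close>, and \<open>0\<close> otherwise.  Hence the coefficient of \<open>dx\<^sup>I \<otimes> dx\<^sup>K\<close> in
  \<open>\<Sum>\<^sub>i \<partial>\<^sub>i \<omega>\<^sub>I\<^sub>J dx\<^sup>I \<otimes> (dx\<^sup>i \<and> dx\<^sup>J)\<close> collects the pairs \<open>i \<in> K\<close>, \<open>J = K - {i}\<close>.  The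
  coordinates are affine for the flat connection.
\<close>

definition dbar :: "('n::{finite,linorder}) form \<Rightarrow> 'n form" where
  "dbar \<omega> = (\<lambda>I K x. if x \<in> orthant
     then \<Sum>i\<in>K. (- 1) ^ card {k \<in> K - {i}. k < i} * pderiv_at i (\<omega> I (K - {i})) x
     else 0)"

text \<open>
  For \<open>h = (g\<^sup>i\<^sup>j)\<close> the inverse of the metric, \<open>wedge_inner h I K\<close> is
  \<open>\<langle>dx\<^sup>I, dx\<^sup>K\<rangle> = det (h i k)\<close>, \<open>i \<in> I\<close>, \<open>k \<in> K\<close>, the inner product induced on exterior
  powers (normalised so that wedge products of an orthonormal coframe are orthonormal).
\<close>

definition wedge_inner :: "real ^ ('n::{finite,linorder}) ^ ('n::{finite,linorder}) \<Rightarrow> 'n set \<Rightarrow> 'n set \<Rightarrow> real" where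
  "wedge_inner h I K =
     (if card I = card K then
        \<Sum>\<sigma> | \<sigma> permutes {..<card I}.
          of_int (sign \<sigma>) *
          (\<Prod>r<card I. h $ (sorted_list_of_set I ! r) $ (sorted_list_of_set K ! \<sigma> r))
      else 0)"

definition form_inner_at ::
    "('n::{finite,linorder}) metric \<Rightarrow> 'n form \<Rightarrow> 'n form \<Rightarrow> real ^ ('n::{finite,linorder}) \<Rightarrow> real" where
  "form_inner_at g \<omega> \<eta> x =
     (\<Sum>I\<in>UNIV. \<Sum>J\<in>UNIV. \<Sum>K\<in>UNIV. \<Sum>L\<in>UNIV.
        \<omega> I J x * \<eta> K L x *
        wedge_inner (matrix_inv (g x)) I K * wedge_inner (matrix_inv (g x)) J L)"

definition riemannian_volume :: "('n::finite) metric \<Rightarrow> (real ^ 'n) measure" where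
  "riemannian_volume g =
     density lborel (\<lambda>x. ennreal (indicator orthant x * sqrt (det (g x))))"

definition form_inner :: "('n::{finite,linorder}) metric \<Rightarrow> 'n form \<Rightarrow> 'n form \<Rightarrow> real" where
  "form_inner g \<omega> \<eta> = (LINT x|riemannian_volume g. form_inner_at g \<omega> \<eta> x)"

definition form_norm :: "('n::{finite,linorder}) metric \<Rightarrow> 'n form \<Rightarrow> real" where
  "form_norm g \<omega> = sqrt (form_inner g \<omega> \<omega>)"

text \<open>The formal adjoint of \<open>dbar\<close>, from \<open>(p,q+1)\<close>-forms to \<open>(p,q)\<close>-forms.\<close>

definition dbar_adjoint ::
    "('n::{finite,linorder}) metric \<Rightarrow> nat \<Rightarrow> int \<Rightarrow> 'n form \<Rightarrow> 'n form" where
  "dbar_adjoint g p q \<eta> =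
     (THE \<zeta>. \<zeta> \<in> smooth_forms p q \<and>
        (\<forall>\<alpha> \<in> test_forms p q. form_inner g (dbar \<alpha>) \<eta> = form_inner g \<alpha> \<zeta>))"

text \<open>
  Square-integrable sections.  Elements are representatives, not classes modulo equality almost
  everywhere; accordingly \<open>form_norm\<close> is a seminorm and the weak operator below is a relation,
  whose second argument is determined almost everywhere by the first.
\<close>

definition L2_forms :: "('n::{finite,linorder}) metric \<Rightarrow> nat \<Rightarrow> int \<Rightarrow> 'n form set" where
  "L2_forms g p q =
     {\<omega> \<in> forms p q. (\<forall>I J. \<omega> I J \<in> borel_measurable borel) \<and>
        integrable (riemannian_volume g) (form_inner_at g \<omega> \<omega>)}"

text \<open>\<open>weak_dbar g p q \<omega> w\<close>: \<open>dbar \<omega> = w\<close> weakly, where \<open>\<omega>\<close> has degree \<open>(p,q)\<close>.\<close>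

definition weak_dbar ::
    "('n::{finite,linorder}) metric \<Rightarrow> nat \<Rightarrow> int \<Rightarrow> 'n form \<Rightarrow> 'n form \<Rightarrow> bool" where
  "weak_dbar g p q \<omega> w \<longleftrightarrow>
     \<omega> \<in> L2_forms g p q \<and> w \<in> L2_forms g p (q + 1) \<and>
     (\<forall>\<eta> \<in> test_forms p (q + 1).
        form_inner g w \<eta> = form_inner g \<omega> (dbar_adjoint g p q \<eta>))"

definition dbar_domain :: "('n::{finite,linorder}) metric \<Rightarrow> nat \<Rightarrow> int \<Rightarrow> 'n form set" where
  "dbar_domain g p q = {\<omega> \<in> L2_forms g p q. \<exists>w. weak_dbar g p q \<omega> w}"

definition dbar_ker :: "('n::{finite,linorder}) metric \<Rightarrow> nat \<Rightarrow> int \<Rightarrow> 'n form set" where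
  "dbar_ker g p q = {\<omega> \<in> dbar_domain g p q. weak_dbar g p q \<omega> 0}"

text \<open>The image of \<open>dbar\<close> in degree \<open>(p,q)\<close>.\<close>

definition dbar_im :: "('n::{finite,linorder}) metric \<Rightarrow> nat \<Rightarrow> int \<Rightarrow> 'n form set" where
  "dbar_im g p q =
     {w \<in> dbar_domain g p q. \<exists>u \<in> dbar_domain g p (q - 1). weak_dbar g p (q - 1) u w}"

definition L2_closure ::
    "('n::{finite,linorder}) metric \<Rightarrow> nat \<Rightarrow> int \<Rightarrow> 'n form set \<Rightarrow> 'n form set" where
  "L2_closure g p q S =
     {\<omega> \<in> L2_forms g p q. \<forall>\<epsilon>>0. \<exists>\<eta>\<in>S. form_norm g (\<omega> - \<eta>) < \<epsilon>}"

text \<open>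
  The closure of the image contains every form of norm \<open>0\<close>, so the quotient below also
  identifies forms that agree almost everywhere.
\<close>

definition cohomologous ::
    "('n::{finite,linorder}) metric \<Rightarrow> nat \<Rightarrow> int \<Rightarrow> ('n form \<times> 'n form) set" where
  "cohomologous g p q =
     {(\<omega>, \<eta>). \<omega> \<in> dbar_ker g p q \<and> \<eta> \<in> dbar_ker g p q \<and>
        \<omega> - \<eta> \<in> L2_closure g p q (dbar_im g p q)}"

definition L2_cohomology ::
    "('n::{finite,linorder}) metric \<Rightarrow> nat \<Rightarrow> int \<Rightarrow> 'n form set set" where
  "L2_cohomology g p q = dbar_ker g p q // cohomologous g p q"

definition L2_cohomology_zero ::
    "('n::{finite,linorder}) metric \<Rightarrow> nat \<Rightarrow> int \<Rightarrow> 'n form set" where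
  "L2_cohomology_zero g p q = cohomologous g p q `` {0}"

definition orthant_metric :: "('n::finite) metric" where
  "orthant_metric x = (\<chi> i j. if i = j then 1 / (x $ j)\<^sup>2 else 0)"

end

theory Submission imports Defs begin

text \<open>
  In the coordinates \<open>t\<^sup>i = ln x\<^sup>i\<close> the metric is Euclidean and \<open>dx\<^sup>I\<close> has length
  \<open>\<Prod>i\<in>I. x\<^sup>i\<close>, so the component of \<open>dbar\<close> at a fixed \<open>I\<close> is the exterior derivative on
  the Euclidean space with weight \<open>exp (2 * (\<Sum>i\<in>I. t\<^sup>i))\<close>.  Let \<open>X\<close> be the sum of the
  \<open>\<partial>/\<partial>t\<^sup>i\<close>, \<open>i \<in> I\<close>; then \<open>\<bar>X\<bar>\<^sup>2 = p\<close>, and pulling back by its flow \<open>\<phi>\<^sub>s\<close> multiplies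
  the weighted norm by \<open>exp (- p * s)\<close>.  By Cartan's formula
  \<open>u = - \<integral> \<phi>\<^sub>s\<^sup>* (i\<^sub>X v) ds\<close>, over \<open>s \<ge> 0\<close>, is a primitive of a closed \<open>v\<close>, and its norm is
  at most \<open>1/p\<close> times that of \<open>i\<^sub>X v\<close>, which is at most \<open>sqrt p\<close> times that of \<open>v\<close>.
  All of this is carried out weakly: the flow and the contraction are moved to the test form, where
  Cartan's formula for the adjoints holds pointwise.
\<close>

section \<open>Smooth functions\<close>

text \<open>\<open>weak_dbar\<close> gives access to a closed form only through pairings with
  \<open>dbar_adjoint\<close> of test forms, and this shapes the argument twice.
  \<open>dbar_adjoint\<close> is a definite description over smooth forms, so it has to be computed:
  existence comes from integration by parts, uniqueness from bump functions. Moreover, the adjoint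
  of the homotopy operator need not preserve test forms: the supports of the translates of \<psi> by
  the backward flow drift to infinity, so their average over s has no compact support in general.
  Hence the integral over s stays outside, closedness is applied to each translate separately, and
  only the terms left by Cartan's formula are averaged; they form an s-derivative and integrate back
  to \<psi>. In frame coefficients the weight disappears from the norm: the flow acts by isometries
  and the factor exp (- p s) becomes an explicit part of the average. The hypothesis p \<ge> 1
  enters as X \<noteq> 0, which makes exp (- p s) integrable over s \<ge> 0 and lets the flow leave
  every compact set.\<close>

lemma open_orthant: "open (orthant :: (real ^ 'n::finite) set)"
proof -
  have "orthant = (\<Inter>i. {x :: real ^ 'n. 0 < x $ i})"
    by (auto simp: orthant_def)
  moreover have "open (\<Inter>i. {x :: real ^ 'n. 0 < x $ i})"
    by (intro open_INT finite ballI open_Collect_less continuous_intros)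
  ultimately show ?thesis
    by (simp only:)
qed

lemma pderiv_at_eq: "(f has_derivative D) (at x) \<Longrightarrow> pderiv_at i f x = D (axis i 1)"
  unfolding pderiv_at_def by (metis frechet_derivative_at)

lemma has_derivative_cong_open:
  assumes "open S" "x \<in> S" "\<And>y. y \<in> S \<Longrightarrow> f y = g y"
  shows "(f has_derivative D) (at x) \<longleftrightarrow> (g has_derivative D) (at x)"
proof
  show "(g has_derivative D) (at x)" if "(f has_derivative D) (at x)"
    using that assms by (rule has_derivative_transform_within_open)
  show "(f has_derivative D) (at x)" if "(g has_derivative D) (at x)"
    using that assms(1,2) by (rule has_derivative_transform_within_open) (simp add: assms(3))
qed

text \<open>\<open>frechet_derivative\<close> is a choice among derivatives. Both functions have the
  same derivatives at \<open>x\<close>, so the choices coincide even where neither function is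
  differentiable.\<close>

lemma pderiv_at_cong_open:
  assumes "open S" "x \<in> S" "\<And>y. y \<in> S \<Longrightarrow> f y = g y"
  shows "pderiv_at i f x = pderiv_at i g x"
  unfolding pderiv_at_def frechet_derivative_def
  using has_derivative_cong_open[OF assms] by simp

lemma Ck_on_cong:
  assumes "open S" "\<And>x. x \<in> S \<Longrightarrow> f x = g x"
  shows "Ck_on k S f = Ck_on k S g"
  using assms(2)
proof (induction k arbitrary: f g)
  case 0
  then show ?case by (simp cong: continuous_on_cong)
next
  case (Suc k)
  have "f differentiable_on S \<longleftrightarrow> g differentiable_on S"
    unfolding differentiable_on_eq_differentiable_at[OF assms(1)] differentiable_def
    by (intro ball_cong refl ex_cong1 has_derivative_cong_open[OF assms(1)] Suc.prems)
  moreover have "Ck_on k S (pderiv_at i f) = Ck_on k S (pderiv_at i g)" for i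
    using Suc.prems by (intro Suc.IH pderiv_at_cong_open[OF assms(1)])
  ultimately show ?case by simp
qed

lemma Ck_on_transform:
  assumes "open S" "Ck_on k S f" "\<And>x. x \<in> S \<Longrightarrow> g x = f x"
  shows "Ck_on k S g"
  using assms(2) Ck_on_cong[OF assms(1,3)] by (rule iffD2[rotated])

lemma Ck_on_Suc_imp: "Ck_on (Suc k) S f \<Longrightarrow> Ck_on k S f"
proof (induction k arbitrary: f)
  case 0
  then show ?case by (simp add: differentiable_imp_continuous_on)
qed auto

lemma Ck_on_Un:
  assumes "open A" "open B" "Ck_on k A f" "Ck_on k B f"
  shows "Ck_on k (A \<union> B) f"
  using assms(3,4)
proof (induction k arbitrary: f)
  case 0
  then show ?case using assms(1,2) by (simp add: continuous_on_open_Un)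
next
  case (Suc k)
  then show ?case
    using assms(1,2) by (auto simp: differentiable_on_eq_differentiable_at open_Un)
qed

text \<open>Membership in a family stable under partial derivatives gives every order of
  differentiability at once, without a formula for iterated derivatives.\<close>

lemma Ck_on_coinduct:
  assumes "open S" "f \<in> F"
    and "\<And>f. f \<in> F \<Longrightarrow> f differentiable_on S"
    and "\<And>f i. f \<in> F \<Longrightarrow> \<exists>g\<in>F. \<forall>x\<in>S. pderiv_at i f x = g x"
  shows "Ck_on k S f"
  using assms(2)
proof (induction k arbitrary: f)
  case 0
  then show ?case using assms(3) by (simp add: differentiable_imp_continuous_on)
next
  case (Suc k)
  have "Ck_on k S (pderiv_at i f)" for i
  proof -
    obtain g where "g \<in> F" "\<And>x. x \<in> S \<Longrightarrow> pderiv_at i f x = g x"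
      using assms(4)[OF Suc.prems, of i] by blast
    then show ?thesis
      by (intro Ck_on_transform[OF assms(1) Suc.IH])
  qed
  then show ?case using assms(3) Suc.prems by simp
qed

lemma pderiv_at_add:
  assumes "f differentiable at x" "g differentiable at x"
  shows "pderiv_at i (\<lambda>x. f x + g x) x = pderiv_at i f x + pderiv_at i g x"
proof -
  have "((\<lambda>x. f x + g x) has_derivative
      (\<lambda>h. frechet_derivative f (at x) h + frechet_derivative g (at x) h)) (at x)"
    using assms frechet_derivative_works by (intro has_derivative_add) auto
  from pderiv_at_eq[OF this] show ?thesis by (simp add: pderiv_at_def)
qed

lemma pderiv_at_mult:
  assumes "f differentiable at x" "g differentiable at x"
  shows "pderiv_at i (\<lambda>x. f x * g x) x = f x * pderiv_at i g x + pderiv_at i f x * g x"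
proof -
  have "((\<lambda>x. f x * g x) has_derivative
      (\<lambda>h. f x * frechet_derivative g (at x) h + frechet_derivative f (at x) h * g x)) (at x)"
    using assms frechet_derivative_works by (intro has_derivative_mult) auto
  from pderiv_at_eq[OF this] show ?thesis by (simp add: pderiv_at_def)
qed

lemma Ck_on_add:
  assumes "open S" "Ck_on k S f" "Ck_on k S g"
  shows "Ck_on k S (\<lambda>x. f x + g x)"
  using assms(2,3)
proof (induction k arbitrary: f g)
  case 0
  then show ?case by (simp add: continuous_on_add)
next
  case (Suc k)
  have "Ck_on k S (pderiv_at i (\<lambda>x. f x + g x))" for i
  proof -
    have "Ck_on k S (\<lambda>x. pderiv_at i f x + pderiv_at i g x)"
      using Suc by simp
    moreover have "pderiv_at i (\<lambda>x. f x + g x) x = pderiv_at i f x + pderiv_at i g x" if "x \<in> S" for x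
      using Suc.prems that
      by (intro pderiv_at_add) (auto simp: differentiable_on_eq_differentiable_at[OF assms(1)])
    ultimately show ?thesis
      by (rule Ck_on_transform[OF assms(1)])
  qed
  then show ?case using Suc.prems by (auto intro: differentiable_on_add)
qed

lemma Ck_on_mult:
  assumes "open S" "Ck_on k S f" "Ck_on k S g"
  shows "Ck_on k S (\<lambda>x. f x * g x)"
  using assms(2,3)
proof (induction k arbitrary: f g)
  case 0
  then show ?case by (simp add: continuous_on_mult)
next
  case (Suc k)
  have "Ck_on k S (pderiv_at i (\<lambda>x. f x * g x))" for i
  proof -
    have "Ck_on k S (\<lambda>x. f x * pderiv_at i g x + pderiv_at i f x * g x)"
      using Suc.prems Ck_on_Suc_imp[OF Suc.prems(1)] Ck_on_Suc_imp[OF Suc.prems(2)]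
      by (intro Ck_on_add[OF assms(1)] Suc.IH) auto
    moreover have "pderiv_at i (\<lambda>x. f x * g x) x = f x * pderiv_at i g x + pderiv_at i f x * g x" if "x \<in> S" for x
      using Suc.prems that
      by (intro pderiv_at_mult) (auto simp: differentiable_on_eq_differentiable_at[OF assms(1)])
    ultimately show ?thesis
      by (rule Ck_on_transform[OF assms(1)])
  qed
  moreover have "(\<lambda>x. f x * g x) differentiable_on S"
    using Suc.prems by (auto simp: differentiable_on_def)
  ultimately show ?case by simp
qed

lemma pderiv_at_const: "pderiv_at i (\<lambda>x. c) x = 0"
  using pderiv_at_eq[OF has_derivative_const] .

lemma Ck_on_const: "open S \<Longrightarrow> Ck_on k S (\<lambda>x. c)"
  by (rule Ck_on_coinduct[where F = "range (\<lambda>c x. c)"]) (auto simp: pderiv_at_const)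

text \<open>\<open>H\<close> is a family of one-variable functions stable under differentiation on
  \<open>T\<close>. Composed with a coordinate it becomes a family for \<open>Ck_on_coinduct\<close>
  once the zero function, the derivative in all other directions, is added.\<close>

lemma Ck_on_coordinate:
  assumes "open T" "h \<in> H"
    and "\<And>h. h \<in> H \<Longrightarrow> \<exists>h'\<in>H. \<forall>t\<in>T. (h has_real_derivative h' t) (at t)"
    and "open S" "\<And>x. x \<in> S \<Longrightarrow> x $ i \<in> T"
  shows "Ck_on k S (\<lambda>x. h (x $ i))"
proof (rule Ck_on_coinduct[where F = "insert (\<lambda>x. 0) ((\<lambda>h x. h (x $ i)) ` H)"])
  show "open S" by fact
  show "(\<lambda>x. h (x $ i)) \<in> insert (\<lambda>x. 0) ((\<lambda>h x. h (x $ i)) ` H)" using assms(2) by simp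
next
  have der: "((\<lambda>x. h (x $ i)) has_derivative (\<lambda>y. D * y $ i)) (at x)"
    if "(h has_real_derivative D) (at (x $ i))" for h D and x :: "real ^ 'a"
    using DERIV_compose_FDERIV[OF that
        bounded_linear_imp_has_derivative[OF bounded_linear_vec_nth]]
    by (simp add: mult.commute)
  show "f differentiable_on S" if f: "f \<in> insert (\<lambda>x. 0) ((\<lambda>h x. h (x $ i)) ` H)" for f
  proof (cases "f = (\<lambda>x. 0)")
    case False
    then obtain h where h: "h \<in> H" "f = (\<lambda>x. h (x $ i))" using f by auto
    have "f differentiable at x" if "x \<in> S" for x
      using der assms(3)[OF h(1)] assms(5)[OF that] unfolding h(2) differentiable_def by blast
    then show ?thesis by (simp add: differentiable_on_eq_differentiable_at[OF assms(4)])
  qed simp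
  show "\<exists>g\<in>insert (\<lambda>x. 0) ((\<lambda>h x. h (x $ i)) ` H). \<forall>x\<in>S. pderiv_at j f x = g x"
    if f: "f \<in> insert (\<lambda>x. 0) ((\<lambda>h x. h (x $ i)) ` H)" for f j
  proof (cases "f = (\<lambda>x. 0)")
    case True
    then show ?thesis by (auto simp: pderiv_at_const)
  next
    case False
    then obtain h where h: "h \<in> H" "f = (\<lambda>x. h (x $ i))" using f by auto
    obtain h' where h': "h' \<in> H" "\<forall>t\<in>T. (h has_real_derivative h' t) (at t)"
      using assms(3) h(1) by blast
    have "pderiv_at j f x = (if i = j then h' (x $ i) else 0)" if "x \<in> S" for x
      using pderiv_at_eq[OF der, of h "h' (x $ i)" x j] h h' assms(5) that by (auto simp: axis_def)
    then show ?thesis using h' by auto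
  qed
qed

section \<open>The flat function exp (- 1/t) and its derivatives\<close>

definition flat :: "real poly \<Rightarrow> real \<Rightarrow> real" where
  "flat P t = (if t > 0 then poly P (inverse t) * exp (- inverse t) else 0)"

lemma poly_times_exp_neg_at_top: "((\<lambda>t. poly P t * exp (- t)) \<longlongrightarrow> 0) at_top"
  for P :: "real poly"
proof -
  have "((\<lambda>t. \<Sum>i\<le>degree P. coeff P i * (t ^ i / exp t)) \<longlongrightarrow> (\<Sum>i\<le>degree P. coeff P i * 0)) at_top"
    by (intro tendsto_intros tendsto_power_div_exp_0)
  moreover have "(\<lambda>t. poly P t * exp (- t)) = (\<lambda>t. \<Sum>i\<le>degree P. coeff P i * (t ^ i / exp t))"
    by (simp add: poly_altdef sum_distrib_right exp_minus divide_inverse mult.assoc)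
  ultimately show ?thesis by simp
qed

lemma flat_tendsto_0: "(flat P \<longlongrightarrow> 0) (at 0)"
proof (rule filterlim_split_at)
  have "\<forall>\<^sub>F t in at_left 0. flat P t = 0"
    by (rule eventually_at_leftI[of "-1"]) (auto simp: flat_def)
  then show "(flat P \<longlongrightarrow> 0) (at_left 0)"
    by (simp add: tendsto_eventually)
next
  have "((\<lambda>t. poly P (inverse t) * exp (- inverse t)) \<longlongrightarrow> 0) (at_right 0)"
    using filterlim_compose[OF poly_times_exp_neg_at_top filterlim_inverse_at_top_right] .
  moreover have "\<forall>\<^sub>F t in at_right 0. poly P (inverse t) * exp (- inverse t) = flat P t"
    by (rule eventually_at_rightI[of 0 1]) (auto simp: flat_def)
  ultimately show "(flat P \<longlongrightarrow> 0) (at_right 0)"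
    using Lim_transform_eventually by blast
qed

text \<open>With u = 1/t one has du/dt = - u^2, so P(u) exp (- u) has derivative u^2 (P(u) - P'(u))
  exp (- u); the polynomial \<open>[:0, 0, 1:]\<close> is u^2.\<close>

lemma flat_has_derivative:
  "(flat P has_real_derivative flat ([:0, 0, 1:] * (P - pderiv P)) t) (at t)"
proof -
  consider "t < 0" | "t = 0" | "t > 0" by linarith
  then show ?thesis
  proof cases
    case 1
    have "((\<lambda>_. 0) has_real_derivative 0) (at t)" by simp
    then have "(flat P has_real_derivative 0) (at t)"
      by (rule has_field_derivative_transform_within_open[where S = "{..<0}"])
         (use 1 in \<open>auto simp: flat_def\<close>)
    then show ?thesis using 1 by (simp add: flat_def)
  next
    case 2
    \<comment> \<open>The difference quotient at 0 is again a flat function, with polynomial u P,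
      and therefore tends to 0.\<close>
    have "(flat P y - flat P 0) / (y - 0) = flat ([:0, 1:] * P) y" for y
      by (simp add: flat_def field_simps)
    then show ?thesis
      using flat_tendsto_0[of "[:0, 1:] * P"] 2 by (simp add: has_field_derivative_iff flat_def[of _ 0])
  next
    case 3
    have "((\<lambda>t. poly P (inverse t) * exp (- inverse t)) has_real_derivative
        poly (pderiv P) (inverse t) * (- (inverse t)\<^sup>2) * exp (- inverse t)
         + poly P (inverse t) * (exp (- inverse t) * (inverse t)\<^sup>2)) (at t)"
      using 3 by (auto intro!: derivative_eq_intros simp: power2_eq_square)
    then have "(flat P has_real_derivative
        poly (pderiv P) (inverse t) * (- (inverse t)\<^sup>2) * exp (- inverse t)
         + poly P (inverse t) * (exp (- inverse t) * (inverse t)\<^sup>2)) (at t)"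
      by (rule has_field_derivative_transform_within_open[where S = "{0<..}"])
         (use 3 in \<open>auto simp: flat_def\<close>)
    then show ?thesis using 3 by (simp add: flat_def algebra_simps power2_eq_square)
  qed
qed

lemma Ck_on_flat_coordinate: "Ck_on k UNIV (\<lambda>x. flat P (c * x $ i + d))"
proof -
  \<comment> \<open>The scalar \<open>e\<close> absorbs the powers of \<open>c\<close> produced by
    the chain rule.\<close>
  define H where "H = {h. \<exists>e P. h = (\<lambda>t. e * flat P (c * t + d))}"
  have der: "((\<lambda>t. e * flat P (c * t + d)) has_real_derivative
      (e * c) * flat ([:0, 0, 1:] * (P - pderiv P)) (c * t + d)) (at t)" for e P t
  proof -
    have "((\<lambda>t. c * t + d) has_real_derivative c) (at t)"
      by (auto intro!: derivative_eq_intros)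
    from DERIV_cmult[OF DERIV_chain2[OF flat_has_derivative this], of e] show ?thesis
      by (simp only: mult_ac)
  qed
  have H1: "\<exists>h'\<in>H. \<forall>t\<in>UNIV. (h has_real_derivative h' t) (at t)" if h: "h \<in> H" for h
  proof -
    obtain e P where h: "h = (\<lambda>t. e * flat P (c * t + d))" using h unfolding H_def by auto
    show ?thesis
    proof
      show "\<forall>t\<in>UNIV. (h has_real_derivative (e * c) * flat ([:0, 0, 1:] * (P - pderiv P)) (c * t + d)) (at t)"
        unfolding h by (intro ballI der)
      show "(\<lambda>t. (e * c) * flat ([:0, 0, 1:] * (P - pderiv P)) (c * t + d)) \<in> H"
        unfolding H_def by blast
    qed
  qed
  have "(\<lambda>t. flat P (c * t + d)) = (\<lambda>t. 1 * flat P (c * t + d))"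
    by simp
  then have H0: "(\<lambda>t. flat P (c * t + d)) \<in> H"
    unfolding H_def by blast
  show ?thesis
    by (rule Ck_on_coordinate[OF open_UNIV H0 H1 open_UNIV UNIV_I])
qed

lemma pderiv_at_cmult:
  assumes "f differentiable at x"
  shows "pderiv_at i (\<lambda>x. c * f x) x = c * pderiv_at i f x"
  using pderiv_at_mult[OF differentiable_const assms, of i c] by (simp add: pderiv_at_const)

definition smooth_on :: "(real ^ 'n::finite) set \<Rightarrow> (real ^ 'n \<Rightarrow> real) \<Rightarrow> bool" where
  "smooth_on S f \<longleftrightarrow> (\<forall>k. Ck_on k S f)"

lemma smooth_on_mult: "open S \<Longrightarrow> smooth_on S f \<Longrightarrow> smooth_on S g \<Longrightarrow> smooth_on S (\<lambda>x. f x * g x)"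
  by (simp add: smooth_on_def Ck_on_mult)

lemma smooth_on_add: "open S \<Longrightarrow> smooth_on S f \<Longrightarrow> smooth_on S g \<Longrightarrow> smooth_on S (\<lambda>x. f x + g x)"
  by (simp add: smooth_on_def Ck_on_add)

lemma smooth_on_const: "open S \<Longrightarrow> smooth_on S (\<lambda>x. c)"
  by (simp add: smooth_on_def Ck_on_const)

lemma smooth_on_pderiv: "smooth_on S f \<Longrightarrow> smooth_on S (pderiv_at i f)"
  unfolding smooth_on_def using Ck_on.simps(2) by blast

lemma smooth_on_prod:
  "open S \<Longrightarrow> (\<And>i. i \<in> A \<Longrightarrow> smooth_on S (f i)) \<Longrightarrow> smooth_on S (\<lambda>x. \<Prod>i\<in>A. f i x)"
  by (induction A rule: infinite_finite_induct) (auto simp: smooth_on_const intro!: smooth_on_mult)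

lemma smooth_on_imp_differentiable: "open S \<Longrightarrow> smooth_on S f \<Longrightarrow> x \<in> S \<Longrightarrow> f differentiable at x"
  unfolding smooth_on_def using Ck_on.simps(2)[of 0] differentiable_on_eq_differentiable_at by blast

lemma smooth_on_imp_continuous_on: "smooth_on S f \<Longrightarrow> continuous_on S f"
  unfolding smooth_on_def using Ck_on.simps(1) by blast

lemma smooth_on_inverse_coordinate: "smooth_on orthant (\<lambda>x. inverse (x $ i))"
  unfolding smooth_on_def
proof
  fix k
  define H :: "(real \<Rightarrow> real) set" where "H = {h. \<exists>c m. h = (\<lambda>t. c * inverse t ^ m)}"
  have H1: "\<exists>h'\<in>H. \<forall>t\<in>{0<..}. (h has_real_derivative h' t) (at t)" if h: "h \<in> H" for h
  proof -
    obtain c m where h: "h = (\<lambda>t. c * inverse t ^ m)" using h unfolding H_def by auto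
    show ?thesis
    proof
      show "(\<lambda>t. (- c * real m) * inverse t ^ Suc m) \<in> H"
        unfolding H_def by blast
      show "\<forall>t\<in>{0<..}. (h has_real_derivative (- c * real m) * inverse t ^ Suc m) (at t)"
      proof
        fix t :: real assume t: "t \<in> {0<..}"
        have "((\<lambda>t. inverse t) has_real_derivative - (inverse t ^ 2)) (at t)"
          using t by (auto intro!: derivative_eq_intros simp: power2_eq_square)
        from DERIV_cmult[OF DERIV_power[OF this, of m], of c]
        show "(h has_real_derivative (- c * real m) * inverse t ^ Suc m) (at t)"
          unfolding h by (cases m) (simp_all add: power2_eq_square mult_ac)
      qed
    qed
  qed
  have "(\<lambda>t. inverse t :: real) = (\<lambda>t. 1 * inverse t ^ 1)" by simp
  then have H0: "(\<lambda>t. inverse t) \<in> H"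
    unfolding H_def by blast
  show "Ck_on k orthant (\<lambda>x :: real ^ 'a. inverse (x $ i))"
    by (rule Ck_on_coordinate[OF open_greaterThan H0 H1 open_orthant]) (auto simp: orthant_def)
qed

lemma pderiv_at_coordinate: "pderiv_at i (\<lambda>x. x $ j) x = (if i = j then 1 else 0)"
  using pderiv_at_eq[OF bounded_linear_imp_has_derivative[OF bounded_linear_vec_nth[of j]], of i x]
  by (simp add: axis_def eq_commute)

lemma smooth_on_coordinate: "open S \<Longrightarrow> smooth_on S (\<lambda>x. x $ i)"
  unfolding smooth_on_def
proof
  fix k assume "open S"
  then show "Ck_on k S (\<lambda>x. x $ i)"
    by (rule Ck_on_coinduct[where F = "insert (\<lambda>x. x $ i) (range (\<lambda>c x. c))"])
       (auto simp: pderiv_at_coordinate pderiv_at_const bounded_linear_imp_differentiable_on bounded_linear_vec_nth)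
qed

section \<open>Scalar test functions and bump functions\<close>

definition test_functions :: "(real ^ 'n::finite \<Rightarrow> real) set" where
  "test_functions =
     {f. smooth_on orthant f \<and> (\<exists>K. compact K \<and> K \<subseteq> orthant \<and> (\<forall>x. x \<notin> K \<longrightarrow> f x = 0))}"

lemma test_functions_support:
  "f \<in> test_functions \<Longrightarrow> \<exists>K. compact K \<and> K \<subseteq> orthant \<and> (\<forall>x. x \<notin> K \<longrightarrow> f x = 0)"
  by (simp add: test_functions_def)

lemma test_functionsI:
  "smooth_on orthant f \<Longrightarrow> compact K \<Longrightarrow> K \<subseteq> orthant \<Longrightarrow> (\<And>x. x \<notin> K \<Longrightarrow> f x = 0)
    \<Longrightarrow> f \<in> test_functions"
  unfolding test_functions_def by blast

lemma test_functions_smooth_on_orthant: "f \<in> test_functions \<Longrightarrow> smooth_on orthant f"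
  by (simp add: test_functions_def)

text \<open>The orthant and the complement of the support are open and cover the space, and the
  function is smooth on each. Differentiability is then available at every point, inside the orthant
  or not.\<close>

lemma test_functions_smooth: "f \<in> test_functions \<Longrightarrow> smooth_on UNIV f"
  unfolding smooth_on_def
proof
  fix k assume f: "f \<in> test_functions"
  obtain K where K: "compact K" "K \<subseteq> orthant" "\<forall>x. x \<notin> K \<longrightarrow> f x = 0"
    using test_functions_support[OF f] by blast
  have o: "open (- K)" using K(1) by (simp add: compact_imp_closed open_Compl)
  have "Ck_on k (- K) f"
    by (rule Ck_on_transform[OF o Ck_on_const[OF o, of _ 0]]) (use K in auto)
  moreover have "Ck_on k orthant f"
    using test_functions_smooth_on_orthant[OF f] unfolding smooth_on_def by blast
  ultimately have "Ck_on k (orthant \<union> - K) f"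
    using Ck_on_Un[OF open_orthant o] by blast
  moreover have "orthant \<union> - K = UNIV" using K by auto
  ultimately show "Ck_on k UNIV f" by simp
qed

lemma test_functions_differentiable: "f \<in> test_functions \<Longrightarrow> f differentiable at x"
  using smooth_on_imp_differentiable[OF open_UNIV test_functions_smooth UNIV_I] .

lemma test_functions_continuous: "f \<in> test_functions \<Longrightarrow> continuous_on UNIV f"
  using smooth_on_imp_continuous_on test_functions_smooth by blast

lemma test_functions_borel: "f \<in> test_functions \<Longrightarrow> f \<in> borel_measurable borel"
  using test_functions_continuous borel_measurable_continuous_onI by blast

lemma test_functions_outside: "f \<in> test_functions \<Longrightarrow> x \<notin> orthant \<Longrightarrow> f x = 0"
  using test_functions_support by blast

lemma test_functions_0: "(\<lambda>x. 0) \<in> test_functions"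
  by (rule test_functionsI[where K = "{}"]) (simp_all add: smooth_on_const open_orthant)

lemma test_functions_smooth_mult:
  "smooth_on orthant g \<Longrightarrow> f \<in> test_functions \<Longrightarrow> (\<lambda>x. g x * f x) \<in> test_functions"
proof -
  assume g: "smooth_on orthant g" and f: "f \<in> test_functions"
  obtain K where K: "compact K" "K \<subseteq> orthant" "\<forall>x. x \<notin> K \<longrightarrow> f x = 0"
    using test_functions_support[OF f] by blast
  show ?thesis
    by (rule test_functionsI[OF _ K(1,2)])
       (use g f K(3) in \<open>simp_all add: smooth_on_mult open_orthant test_functions_smooth_on_orthant\<close>)
qed

lemma test_functions_cmult: "f \<in> test_functions \<Longrightarrow> (\<lambda>x. c * f x) \<in> test_functions"
  by (intro test_functions_smooth_mult smooth_on_const open_orthant)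

lemma test_functions_mult: "f \<in> test_functions \<Longrightarrow> g \<in> test_functions \<Longrightarrow> (\<lambda>x. f x * g x) \<in> test_functions"
  by (intro test_functions_smooth_mult test_functions_smooth_on_orthant)

lemma test_functions_add:
  assumes "f \<in> test_functions" "g \<in> test_functions"
  shows "(\<lambda>x. f x + g x) \<in> test_functions"
proof -
  obtain K where K: "compact K" "K \<subseteq> orthant" "\<forall>x. x \<notin> K \<longrightarrow> f x = 0"
    using test_functions_support[OF assms(1)] by blast
  obtain L where L: "compact L" "L \<subseteq> orthant" "\<forall>x. x \<notin> L \<longrightarrow> g x = 0"
    using test_functions_support[OF assms(2)] by blast
  show ?thesis
  proof (rule test_functionsI[where K = "K \<union> L"])
    show "smooth_on orthant (\<lambda>x. f x + g x)"
      using assms by (simp add: smooth_on_add open_orthant test_functions_smooth_on_orthant)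
  qed (use K L in auto)
qed

lemma test_functions_sum:
  "(\<And>i. i \<in> A \<Longrightarrow> f i \<in> test_functions) \<Longrightarrow> (\<lambda>x. \<Sum>i\<in>A. f i x) \<in> test_functions"
  by (induction A rule: infinite_finite_induct) (auto simp: test_functions_0 intro!: test_functions_add)

lemma test_functions_pderiv:
  assumes "f \<in> test_functions"
  shows "pderiv_at i f \<in> test_functions"
proof -
  obtain K where K: "compact K" "K \<subseteq> orthant" "\<forall>x. x \<notin> K \<longrightarrow> f x = 0"
    using test_functions_support[OF assms] by blast
  have o: "open (- K)" using K(1) by (simp add: compact_imp_closed open_Compl)
  have "pderiv_at i f x = 0" if "x \<notin> K" for x
    using pderiv_at_cong_open[OF o, of x f "\<lambda>x. 0" i] K(3) that by (simp add: pderiv_at_const)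
  moreover have "smooth_on orthant (pderiv_at i f)"
    using assms by (intro smooth_on_pderiv test_functions_smooth_on_orthant)
  ultimately show ?thesis
    using K(1,2) by (intro test_functionsI)
qed

text \<open>A product of one-variable bumps: in coordinate i, exp (- 1/t) is taken at t = x_i -
  a_i/2 and at t = 2 a_i - x_i, which confines the support to the interval from a_i/2 to 2 a_i, away
  from 0.\<close>

lemma exists_bump:
  assumes "a \<in> orthant"
  shows "\<exists>b\<in>test_functions. (\<forall>x. 0 \<le> b x) \<and> 0 < b a"
proof -
  define b :: "real ^ 'a \<Rightarrow> real" where
    "b = (\<lambda>x. \<Prod>i\<in>UNIV. flat 1 (1 * x $ i + - (a $ i / 2)) * flat 1 (- 1 * x $ i + 2 * a $ i))"
  have a: "0 < a $ i" for i using assms by (simp add: orthant_def)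
  let ?K = "cbox ((1/2) *\<^sub>R a) (2 *\<^sub>R a)"
  have "0 < b a" unfolding b_def by (intro prod_pos) (use a in \<open>auto simp: flat_def\<close>)
  moreover have "0 \<le> b x" for x unfolding b_def by (intro prod_nonneg) (auto simp: flat_def)
  moreover have "smooth_on orthant b"
    unfolding b_def
  proof (intro smooth_on_prod smooth_on_mult open_orthant)
    fix i
    have "Ck_on k orthant f" if "Ck_on k UNIV f" for k and f :: "real ^ 'a \<Rightarrow> real"
      using that
    proof (induction k arbitrary: f)
      case (Suc k)
      then show ?case by (auto intro: differentiable_on_subset)
    qed (auto intro: continuous_on_subset)
    then show "smooth_on orthant (\<lambda>x :: real ^ 'a. flat 1 (1 * x $ i + - (a $ i / 2)))"
       "smooth_on orthant (\<lambda>x :: real ^ 'a. flat 1 (- 1 * x $ i + 2 * a $ i))"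
      unfolding smooth_on_def using Ck_on_flat_coordinate by blast+
  qed
  moreover have "b x = 0" if "x \<notin> ?K" for x
  proof -
    obtain i where "x $ i < a $ i / 2 \<or> 2 * a $ i < x $ i"
      using \<open>x \<notin> ?K\<close> by (force simp: mem_box_cart not_le)
    then have "flat 1 (1 * x $ i + - (a $ i / 2)) * flat 1 (- 1 * x $ i + 2 * a $ i) = 0"
      by (auto simp: flat_def)
    then show ?thesis unfolding b_def by (meson finite UNIV_I prod_zero)
  qed
  moreover have "?K \<subseteq> orthant"
  proof
    fix x assume x: "x \<in> ?K"
    have "0 < x $ i" for i
    proof -
      have "((1/2) *\<^sub>R a) $ i \<le> x $ i" using x unfolding mem_box_cart by blast
      then show ?thesis using a[of i] by simp
    qed
    then show "x \<in> orthant" by (simp add: orthant_def)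
  qed
  ultimately show ?thesis
    using test_functionsI[OF _ compact_cbox, of b] by blast
qed

section \<open>Dilations of the orthant\<close>

text \<open>This is d/dt^i for t^i = ln x^i, a field of unit length that commutes with all
  dilations.\<close>

definition log_deriv :: "'n::finite \<Rightarrow> (real ^ 'n \<Rightarrow> real) \<Rightarrow> real ^ 'n \<Rightarrow> real" where
  "log_deriv i f x = x $ i * pderiv_at i f x"

lemma log_deriv_test: "f \<in> test_functions \<Longrightarrow> log_deriv i f \<in> test_functions"
  unfolding log_deriv_def[abs_def]
  by (intro test_functions_smooth_mult smooth_on_coordinate open_orthant test_functions_pderiv)

lemma log_deriv_mult:
  assumes "f differentiable at x" "g differentiable at x"
  shows "log_deriv i (\<lambda>x. f x * g x) x = f x * log_deriv i g x + log_deriv i f x * g x"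
  by (simp add: log_deriv_def pderiv_at_mult[OF assms] algebra_simps)

lemma log_deriv_cmult:
  assumes "f differentiable at x"
  shows "log_deriv i (\<lambda>x. c * f x) x = c * log_deriv i f x"
  by (simp add: log_deriv_def pderiv_at_cmult[OF assms])

lemma log_deriv_add:
  assumes "f differentiable at x" "g differentiable at x"
  shows "log_deriv i (\<lambda>x. f x + g x) x = log_deriv i f x + log_deriv i g x"
  by (simp add: log_deriv_def pderiv_at_add[OF assms] algebra_simps)

lemma log_deriv_const: "log_deriv i (\<lambda>x. c) x = 0"
  by (simp add: log_deriv_def pderiv_at_const)

lemma differentiable_monomial: "(\<lambda>x :: real ^ 'n::finite. \<Prod>i\<in>A. x $ i) differentiable at x"
  by (intro smooth_on_imp_differentiable[OF open_UNIV] smooth_on_prod smooth_on_coordinate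
      open_UNIV UNIV_I)

lemma log_deriv_monomial:
  fixes A :: "'n::finite set"
  shows "log_deriv i (\<lambda>x. \<Prod>j\<in>A. x $ j) x = (if i \<in> A then \<Prod>j\<in>A. x $ j else 0)"
proof -
  have "finite A" by simp
  then show ?thesis
  proof (induction A)
    case (insert a A)
    have "log_deriv i (\<lambda>x. x $ a * (\<Prod>j\<in>A. x $ j)) x
        = x $ a * log_deriv i (\<lambda>x. \<Prod>j\<in>A. x $ j) x + log_deriv i (\<lambda>x. x $ a) x * (\<Prod>j\<in>A. x $ j)"
      using smooth_on_imp_differentiable[OF open_UNIV smooth_on_coordinate]
      by (intro log_deriv_mult differentiable_monomial) auto
    moreover have "log_deriv i (\<lambda>x. x $ a) x = (if i = a then x $ a else 0)"
      by (simp add: log_deriv_def pderiv_at_coordinate)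
    ultimately show ?case using insert by auto
  qed (simp add: log_deriv_const)
qed

section \<open>Dilations, which are translations in logarithmic coordinates\<close>

definition dil :: "real ^ 'n \<Rightarrow> real ^ 'n \<Rightarrow> real ^ 'n::finite" where
  "dil y x = (\<chi> i. exp (y $ i) * x $ i)"

lemma dil_nth [simp]: "dil y x $ i = exp (y $ i) * x $ i"
  by (simp add: dil_def)

lemma dil_dil: "dil y (dil z x) = dil (y + z) x"
  by (simp add: vec_eq_iff exp_add)

lemma dil_0 [simp]: "dil 0 x = x"
  by (simp add: vec_eq_iff)

lemma dil_orthant_iff [simp]: "dil y x \<in> orthant \<longleftrightarrow> x \<in> orthant"
  by (simp add: orthant_def zero_less_mult_iff)

lemma bounded_linear_dil: "bounded_linear (dil y)"
  by (rule linear_conv_bounded_linear[THEN iffD1])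
     (auto intro!: linearI simp: vec_eq_iff algebra_simps)

lemma continuous_on_dil: "continuous_on S (dil y)"
  using bounded_linear_dil linear_continuous_on by blast

lemma pderiv_at_dil:
  assumes "f differentiable at (dil y x)"
  shows "pderiv_at i (\<lambda>x. f (dil y x)) x = exp (y $ i) * pderiv_at i f (dil y x)"
    and "(\<lambda>x. f (dil y x)) differentiable at x"
proof -
  let ?D = "frechet_derivative f (at (dil y x))"
  have D: "(f has_derivative ?D) (at (dil y x))"
    using assms frechet_derivative_works by blast
  have c: "((\<lambda>x. f (dil y x)) has_derivative (\<lambda>h. ?D (dil y h))) (at x)"
    by (rule has_derivative_compose[OF bounded_linear_imp_has_derivative[OF bounded_linear_dil] D])
  have "dil y (axis i 1) = exp (y $ i) *\<^sub>R axis i 1"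
    by (auto simp: vec_eq_iff axis_def)
  then show "pderiv_at i (\<lambda>x. f (dil y x)) x = exp (y $ i) * pderiv_at i f (dil y x)"
    unfolding pderiv_at_eq[OF c] using linear_cmul[OF linear_frechet_derivative[OF assms]]
    by (simp add: pderiv_at_def)
  show "(\<lambda>x. f (dil y x)) differentiable at x"
    using c unfolding differentiable_def by blast
qed

lemma smooth_on_dil:
  assumes "smooth_on orthant f"
  shows "smooth_on orthant (\<lambda>x. f (dil y x))"
  unfolding smooth_on_def
proof
  fix k
  have "Ck_on k orthant f" using assms by (simp add: smooth_on_def)
  then show "Ck_on k orthant (\<lambda>x. f (dil y x))"
  proof (induction k arbitrary: f)
    case 0
    then show ?case
      using continuous_on_compose2[OF _ continuous_on_dil[of orthant y], of orthant f]
      by (simp add: image_subset_iff)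
  next
    case (Suc k)
    have d: "f differentiable at (dil y x)" if "x \<in> orthant" for x
      using Suc.prems that by (simp add: differentiable_on_eq_differentiable_at[OF open_orthant])
    have "Ck_on k orthant (pderiv_at i (\<lambda>x. f (dil y x)))" for i
    proof (rule Ck_on_transform[OF open_orthant])
      show "Ck_on k orthant (\<lambda>x. exp (y $ i) * pderiv_at i f (dil y x))"
        using Suc by (intro Ck_on_mult Ck_on_const open_orthant) auto
    qed (simp add: pderiv_at_dil d)
    moreover have "(\<lambda>x. f (dil y x)) differentiable_on orthant"
      using pderiv_at_dil(2)[OF d] by (simp add: differentiable_on_eq_differentiable_at[OF open_orthant])
    ultimately show ?case by simp
  qed
qed

lemma test_functions_dil:
  assumes "f \<in> test_functions"
  shows "(\<lambda>x. f (dil y x)) \<in> test_functions"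
proof -
  obtain K where K: "compact K" "K \<subseteq> orthant" "\<forall>x. x \<notin> K \<longrightarrow> f x = 0"
    using test_functions_support[OF assms] by blast
  show ?thesis
  proof (rule test_functionsI)
    show "smooth_on orthant (\<lambda>x. f (dil y x))"
      by (intro smooth_on_dil test_functions_smooth_on_orthant assms)
    show "compact (dil (- y) ` K)"
      by (rule compact_continuous_image[OF continuous_on_dil K(1)])
    show "dil (- y) ` K \<subseteq> orthant"
      using K(2) by auto
    show "f (dil y x) = 0" if "x \<notin> dil (- y) ` K" for x
    proof -
      have "x = dil (- y) (dil y x)" by (simp add: dil_dil)
      then have "dil y x \<notin> K" using that by blast
      then show ?thesis using K(3) by blast
    qed
  qed
qed

lemma log_deriv_dil:
  assumes "f \<in> test_functions"
  shows "log_deriv i (\<lambda>x. f (dil y x)) x = log_deriv i f (dil y x)"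
  by (simp add: log_deriv_def pderiv_at_dil(1)[OF test_functions_differentiable[OF assms]])

text \<open>The velocity of the curve has the components \<theta>_i times its own coordinates, so
  the chain rule produces exactly logarithmic derivatives.\<close>

lemma flow_has_derivative:
  assumes "f \<in> test_functions"
  shows "((\<lambda>s. f (dil (s *\<^sub>R \<theta>) x)) has_real_derivative
           (\<Sum>i\<in>UNIV. \<theta> $ i * log_deriv i f (dil (s *\<^sub>R \<theta>) x))) (at s)"
proof -
  let ?y = "dil (s *\<^sub>R \<theta>) x"
  let ?w = "\<chi> i. \<theta> $ i * ?y $ i"
  let ?D = "frechet_derivative f (at ?y)"
  have D: "(f has_derivative ?D) (at ?y)"
    using test_functions_differentiable[OF assms] frechet_derivative_works by blast
  then have lin: "linear ?D" by (rule has_derivative_linear)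
  have "((\<lambda>s. dil (s *\<^sub>R \<theta>) x) has_derivative (\<lambda>h. h *\<^sub>R ?w)) (at s)"
  proof (rule has_derivative_componentwise_within[THEN iffD2], rule)
    fix b :: "real ^ 'a" assume "b \<in> Basis"
    then obtain i where b: "b = axis i 1" by (auto simp: Basis_vec_def)
    have "((\<lambda>s. exp (s * \<theta> $ i) * x $ i) has_derivative (\<lambda>h. h * (\<theta> $ i * (exp (s * \<theta> $ i) * x $ i)))) (at s)"
      by (auto intro!: derivative_eq_intros)
    then show "((\<lambda>s. dil (s *\<^sub>R \<theta>) x \<bullet> b) has_derivative (\<lambda>h. h *\<^sub>R ?w \<bullet> b)) (at s)"
      by (simp add: b inner_axis)
  qed
  from has_derivative_compose[OF this D]
  have "((\<lambda>s. f (dil (s *\<^sub>R \<theta>) x)) has_derivative (\<lambda>h. ?D ?w * h)) (at s)"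
    by (simp add: linear_cmul[OF lin] mult.commute)
  moreover have "?D ?w = (\<Sum>i\<in>UNIV. \<theta> $ i * log_deriv i f ?y)"
  proof -
    have "?w = (\<Sum>i\<in>UNIV. ?w $ i *\<^sub>R axis i 1)"
      using basis_expansion[of ?w] by (simp add: scalar_mult_eq_scaleR)
    then have "?D ?w = ?D (\<Sum>i\<in>UNIV. ?w $ i *\<^sub>R axis i 1)"
      by (rule arg_cong)
    also have "\<dots> = (\<Sum>i\<in>UNIV. ?w $ i *\<^sub>R ?D (axis i 1))"
      by (simp only: linear_sum[OF lin] linear_cmul[OF lin])
    finally show ?thesis
      by (simp add: log_deriv_def pderiv_at_def mult.assoc)
  qed
  ultimately show ?thesis
    by (simp add: has_field_derivative_def)
qed

lemma continuous_on_flow: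
  assumes "continuous_on UNIV f"
  shows "continuous_on UNIV (\<lambda>s. f (dil (s *\<^sub>R \<theta>) x) :: real)"
proof -
  have "continuous_on UNIV (\<lambda>s. dil (s *\<^sub>R \<theta>) x)"
    unfolding dil_def by (intro continuous_intros)
  then show ?thesis
    using continuous_on_compose2[OF assms] by blast
qed

section \<open>The invariant volume\<close>

abbreviation orthant_volume :: "(real ^ 'n::finite) measure" where
  "orthant_volume \<equiv> riemannian_volume orthant_metric"

definition vol_density :: "real ^ 'n::finite \<Rightarrow> real" where
  "vol_density x = indicator orthant x * (\<Prod>i\<in>UNIV. inverse (x $ i))"

lemma det_orthant_metric: "det (orthant_metric x) = (\<Prod>i\<in>UNIV. 1 / (x $ i)\<^sup>2)"
  by (subst det_diagonal) (auto simp: orthant_metric_def)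

lemma orthant_volume_eq: "orthant_volume = density lborel (\<lambda>x. ennreal (vol_density x))"
proof -
  have "indicator orthant x * sqrt (det (orthant_metric x)) = vol_density x" for x :: "real ^ 'a"
  proof (cases "x \<in> orthant")
    case True
    have "sqrt (\<Prod>i\<in>UNIV. 1 / (x $ i)\<^sup>2) = (\<Prod>i\<in>UNIV. inverse (x $ i))"
    proof (rule real_sqrt_unique)
      show "(\<Prod>i\<in>UNIV. inverse (x $ i))\<^sup>2 = (\<Prod>i\<in>UNIV. 1 / (x $ i)\<^sup>2)"
        by (simp add: prod_power_distrib inverse_eq_divide power_divide)
      show "0 \<le> (\<Prod>i\<in>UNIV. inverse (x $ i))"
        using True by (intro prod_nonneg) (simp add: orthant_def less_imp_le)
    qed
    then show ?thesis using True by (simp add: vol_density_def det_orthant_metric)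
  qed (simp add: vol_density_def)
  then show ?thesis by (simp add: riemannian_volume_def)
qed

lemma borel_orthant [measurable]: "orthant \<in> sets borel"
  by (rule borel_open[OF open_orthant])

lemma borel_vec_nth [measurable]: "(\<lambda>x :: real ^ 'n::finite. x $ i) \<in> borel_measurable borel"
  by (intro borel_measurable_continuous_onI continuous_intros)

lemma vol_density_borel [measurable]: "vol_density \<in> borel_measurable borel"
  unfolding vol_density_def[abs_def] by measurable

lemma vol_density_nonneg: "0 \<le> vol_density x"
  by (auto simp: vol_density_def orthant_def less_imp_le split: split_indicator intro!: prod_nonneg)

lemma sets_orthant_volume [measurable_cong, simp]: "sets orthant_volume = sets borel"
  by (simp add: orthant_volume_eq)

lemma space_orthant_volume [simp]: "space orthant_volume = UNIV"
  by (simp add: orthant_volume_eq)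

lemma dil_borel [measurable]: "dil y \<in> borel_measurable borel"
  by (intro borel_measurable_continuous_onI continuous_on_dil)

lemma sigma_finite_orthant_volume: "sigma_finite_measure (orthant_volume :: (real ^ 'n::finite) measure)"
  unfolding orthant_volume_eq by (subst sigma_finite_measure.sigma_finite_iff_density_finite[OF sigma_finite_lborel]) auto

lemma lborel_dil:
  fixes y :: "real ^ 'a::finite"
  shows "lborel = density (distr lborel borel (dil y)) (\<lambda>_. ennreal (\<Prod>i\<in>UNIV. exp (y $ i)))"
proof -
  define c where "c b = exp (y \<bullet> b)" for b :: "real ^ 'a"
  have inj: "inj_on (\<lambda>i. axis i (1::real)) (UNIV :: 'a set)"
    by (auto simp: inj_on_def axis_eq_axis)
  have B: "(Basis :: (real ^ 'a) set) = (\<lambda>i. axis i 1) ` UNIV"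
    by (auto simp: Basis_vec_def)
  have "0 + (\<Sum>b\<in>Basis. (c b * (x \<bullet> b)) *\<^sub>R b) = dil y x" for x
  proof -
    have "(\<Sum>b\<in>Basis. (c b * (x \<bullet> b)) *\<^sub>R b) = (\<Sum>i\<in>UNIV. (dil y x $ i) *\<^sub>R axis i 1)"
      unfolding B by (subst sum.reindex[OF inj]) (simp add: c_def inner_axis)
    also have "\<dots> = dil y x"
      using basis_expansion[of "dil y x"] by (simp add: scalar_mult_eq_scaleR)
    finally show ?thesis by simp
  qed
  moreover have "(\<Prod>b\<in>Basis. \<bar>c b\<bar>) = (\<Prod>i\<in>UNIV. exp (y $ i))"
    unfolding B by (subst prod.reindex[OF inj]) (simp add: c_def inner_axis)
  ultimately show ?thesis
    using lborel_affine_euclidean[of c 0] by (simp add: c_def)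
qed

text \<open>In logarithmic coordinates this is translation invariance of Lebesgue measure.
  Concretely, the Jacobian of the dilation cancels against the change of the density, the product of
  the 1/x_i.\<close>

lemma nn_integral_dil:
  assumes [measurable]: "f \<in> borel_measurable borel"
  shows "(\<integral>\<^sup>+ x. f (dil y x) \<partial>orthant_volume) = (\<integral>\<^sup>+ x. f x \<partial>orthant_volume)"
proof -
  let ?c = "\<Prod>i\<in>UNIV. exp (y $ i)"
  have "?c * (\<Prod>i\<in>UNIV. inverse (dil y x $ i)) = (\<Prod>i\<in>UNIV. inverse (x $ i))" for x
    by (subst prod.distrib[symmetric]) (simp add: mult.assoc[symmetric])
  then have "?c * vol_density (dil y x) = vol_density x" for x
    by (simp add: vol_density_def split: split_indicator)
  then have c: "ennreal ?c * ennreal (vol_density (dil y x)) = ennreal (vol_density x)" for x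
    by (simp add: ennreal_mult'[symmetric] prod_nonneg vol_density_nonneg)
  have "(\<integral>\<^sup>+ x. f x \<partial>orthant_volume) = (\<integral>\<^sup>+ x. ennreal (vol_density x) * f x \<partial>lborel)"
    unfolding orthant_volume_eq by (subst nn_integral_density) auto
  also have "\<dots> = (\<integral>\<^sup>+ x. ennreal ?c * (ennreal (vol_density (dil y x)) * f (dil y x)) \<partial>lborel)"
    by (subst lborel_dil[of y]) (simp add: nn_integral_density nn_integral_distr)
  also have "\<dots> = (\<integral>\<^sup>+ x. ennreal (vol_density x) * f (dil y x) \<partial>lborel)"
    by (simp add: c mult.assoc[symmetric])
  also have "\<dots> = (\<integral>\<^sup>+ x. f (dil y x) \<partial>orthant_volume)"
    unfolding orthant_volume_eq by (subst nn_integral_density) auto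
  finally show ?thesis by simp
qed

lemma distr_dil: "distr orthant_volume borel (dil y) = orthant_volume"
proof (rule measure_eqI)
  fix A assume "A \<in> sets (distr orthant_volume borel (dil y))"
  then have [measurable]: "A \<in> sets borel" by simp
  have "emeasure (distr orthant_volume borel (dil y)) A
      = (\<integral>\<^sup>+ x. indicator A (dil y x) \<partial>orthant_volume)"
    by (subst nn_integral_indicator[symmetric], simp, subst nn_integral_distr) auto
  then show "emeasure (distr orthant_volume borel (dil y)) A = emeasure orthant_volume A"
    by (simp add: nn_integral_dil)
qed simp

lemma integrable_dil:
  assumes [measurable]: "f \<in> borel_measurable borel"
  shows "integrable orthant_volume (\<lambda>x. f (dil y x) :: real) \<longleftrightarrow> integrable orthant_volume f"
  by (subst (2) distr_dil[of y, symmetric]) (simp add: integrable_distr_eq)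

lemma integral_dil:
  assumes [measurable]: "f \<in> borel_measurable borel"
  shows "(LINT x|orthant_volume. f (dil y x) :: real) = (LINT x|orthant_volume. f x)"
  by (subst (2) distr_dil[of y, symmetric]) (simp add: integral_distr)

text \<open>The density is smooth on the orthant, so it can be absorbed into the test function; what
  remains is a continuous function of compact support and Lebesgue measure.\<close>

lemma test_functions_integrable:
  assumes "f \<in> test_functions"
  shows "integrable orthant_volume f"
proof -
  have "smooth_on orthant (\<lambda>x :: real ^ 'a. \<Prod>i\<in>UNIV. inverse (x $ i))"
    by (intro smooth_on_prod open_orthant smooth_on_inverse_coordinate)
  then have g: "(\<lambda>x. (\<Prod>i\<in>UNIV. inverse (x $ i)) * f x) \<in> test_functions"
    using assms by (rule test_functions_smooth_mult)
  have eq: "(\<Prod>i\<in>UNIV. inverse (x $ i)) * f x = vol_density x *\<^sub>R f x" for x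
    using test_functions_outside[OF assms] by (auto simp: vol_density_def split: split_indicator)
  have g: "(\<lambda>x. vol_density x *\<^sub>R f x) \<in> test_functions"
    using g by (simp only: eq)
  obtain K where K: "compact K" "\<forall>x. x \<notin> K \<longrightarrow> vol_density x *\<^sub>R f x = 0"
    using test_functions_support[OF g] by blast
  have "integrable lborel (\<lambda>x. indicator K x *\<^sub>R (vol_density x *\<^sub>R f x))"
    using test_functions_continuous[OF g]
    by (intro borel_integrable_compact K(1)) (rule continuous_on_subset, auto)
  moreover have "indicator K x *\<^sub>R (vol_density x *\<^sub>R f x) = vol_density x *\<^sub>R f x" for x
    using K by (auto split: split_indicator)
  ultimately have "integrable lborel (\<lambda>x. vol_density x *\<^sub>R f x)" by (simp only:)
  then show ?thesis
    unfolding orthant_volume_eq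
    by (subst integrable_density) (auto simp: vol_density_nonneg test_functions_borel[OF assms])
qed

section \<open>Joint integrability in time and space\<close>

lemma flow_borel [measurable]:
  fixes \<theta> :: "real ^ 'a::finite"
  shows "(\<lambda>(s, x). dil (s *\<^sub>R \<theta>) x) \<in> borel_measurable (borel \<Otimes>\<^sub>M borel)"
proof -
  have "continuous_on UNIV (\<lambda>z :: real \<times> (real ^ 'a). dil (fst z *\<^sub>R \<theta>) (snd z))"
    unfolding dil_def by (intro continuous_intros)
  then show ?thesis
    unfolding borel_prod split_beta by (rule borel_measurable_continuous_onI)
qed

lemma pair_sigma_finite_orthant: "pair_sigma_finite lborel (orthant_volume :: (real ^ 'n::finite) measure)"
  by (intro pair_sigma_finite.intro sigma_finite_orthant_volume sigma_finite_lborel)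

text \<open>By invariance of the volume the spatial integral of the absolute value of
  \<open>h\<close> along the flow does not depend on s, so Tonelli's criterion reduces to the two
  assumptions.\<close>

lemma flow_integrable:
  fixes c :: "real \<Rightarrow> real" and h :: "real ^ 'n::finite \<Rightarrow> real"
  assumes c: "integrable lborel c" and h: "integrable orthant_volume h"
  shows "integrable (lborel \<Otimes>\<^sub>M orthant_volume) (\<lambda>(s, x). c s * h (dil (s *\<^sub>R \<theta>) x))"
proof -
  interpret pair_sigma_finite lborel "orthant_volume :: (real ^ 'n) measure"
    by (rule pair_sigma_finite_orthant)
  have hb [measurable]: "h \<in> borel_measurable borel"
    using borel_measurable_integrable[OF h]
    by (simp cong: measurable_cong_sets)
  have [measurable]: "c \<in> borel_measurable borel"
    using borel_measurable_integrable[OF c] by simp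
  have [measurable]: "(\<lambda>z. dil (fst z *\<^sub>R \<theta>) (snd z)) \<in> borel_measurable (borel \<Otimes>\<^sub>M borel)"
    using flow_borel by (simp add: split_beta)
  have int: "integrable orthant_volume (\<lambda>x. h (dil y x))" for y
    using h by (simp add: integrable_dil)
  show ?thesis
  proof (rule Fubini_integrable)
    show "(\<lambda>(s, x). c s * h (dil (s *\<^sub>R \<theta>) x)) \<in> borel_measurable (lborel \<Otimes>\<^sub>M orthant_volume)"
      unfolding split_beta by measurable
    have "(LINT x|orthant_volume. \<bar>h (dil y x)\<bar>) = (LINT x|orthant_volume. \<bar>h x\<bar>)" for y
      by (rule integral_dil) simp
    then show "integrable lborel (\<lambda>s. LINT x|orthant_volume. norm (case (s, x) of (s, x) \<Rightarrow> c s * h (dil (s *\<^sub>R \<theta>) x)))"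
      using c by (simp add: abs_mult)
    show "AE s in lborel. integrable orthant_volume (\<lambda>x. case (s, x) of (s, x) \<Rightarrow> c s * h (dil (s *\<^sub>R \<theta>) x))"
      using int by simp
  qed
qed

lemma abs_mult_le_sum_squares: "\<bar>u * v\<bar> \<le> u\<^sup>2 + v\<^sup>2" for u v :: real
proof -
  have "2 * (\<bar>u\<bar> * \<bar>v\<bar>) \<le> u\<^sup>2 + v\<^sup>2"
    using sum_squares_bound[of "\<bar>u\<bar>" "\<bar>v\<bar>"] by (simp add: mult.assoc)
  moreover have "0 \<le> \<bar>u\<bar> * \<bar>v\<bar>" by simp
  ultimately show ?thesis unfolding abs_mult by linarith
qed

text \<open>The product is dominated by a sum of squares, to which \<open>flow_integrable\<close>
  applies. This justifies exchanging the time integral with a pairing.\<close>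

lemma flow_pair_integrable:
  fixes c :: "real \<Rightarrow> real" and a b :: "real ^ 'n::finite \<Rightarrow> real"
  assumes c: "integrable lborel c"
    and [measurable]: "a \<in> borel_measurable borel" "b \<in> borel_measurable borel"
    and a: "integrable orthant_volume (\<lambda>x. (a x)\<^sup>2)" and b: "integrable orthant_volume (\<lambda>x. (b x)\<^sup>2)"
  shows "integrable (lborel \<Otimes>\<^sub>M orthant_volume) (\<lambda>(s, x). c s * a (dil (s *\<^sub>R \<theta>) x) * b x)"
proof -
  have [measurable]: "c \<in> borel_measurable borel"
    using borel_measurable_integrable[OF c] by simp
  have [measurable]: "(\<lambda>z. dil (fst z *\<^sub>R \<theta>) (snd z)) \<in> borel_measurable (borel \<Otimes>\<^sub>M borel)"
    using flow_borel by (simp add: split_beta)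
  have c': "integrable lborel (\<lambda>s. \<bar>c s\<bar>)" using c by simp
  \<comment> \<open>The factor \<open>b\<close> is not moved by the flow; the instance \<theta> = 0
    of the same lemma covers it.\<close>
  have "integrable (lborel \<Otimes>\<^sub>M orthant_volume)
      (\<lambda>z. (case z of (s, x) \<Rightarrow> \<bar>c s\<bar> * (a (dil (s *\<^sub>R \<theta>) x))\<^sup>2)
        + (case z of (s, x) \<Rightarrow> \<bar>c s\<bar> * (b (dil (s *\<^sub>R 0) x))\<^sup>2))"
    using flow_integrable[OF c' a, of \<theta>] flow_integrable[OF c' b, of 0]
    by (rule Bochner_Integration.integrable_add)
  then show ?thesis
  proof (rule Bochner_Integration.integrable_bound)
    show "(\<lambda>(s, x). c s * a (dil (s *\<^sub>R \<theta>) x) * b x) \<in> borel_measurable (lborel \<Otimes>\<^sub>M orthant_volume)"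
      unfolding split_beta by measurable
    have "\<bar>w\<bar> * \<bar>u * v\<bar> \<le> \<bar>w\<bar> * (u\<^sup>2 + v\<^sup>2)" for u v w :: real
      by (intro mult_left_mono abs_mult_le_sum_squares) simp
    then have "\<bar>w * u * v\<bar> \<le> \<bar>\<bar>w\<bar> * u\<^sup>2 + \<bar>w\<bar> * v\<^sup>2\<bar>" for u v w :: real
      by (simp add: abs_mult distrib_left mult.assoc)
    then show "AE z in lborel \<Otimes>\<^sub>M orthant_volume.
       norm (case z of (s, x) \<Rightarrow> c s * a (dil (s *\<^sub>R \<theta>) x) * b x) \<le>
       norm ((case z of (s, x) \<Rightarrow> \<bar>c s\<bar> * (a (dil (s *\<^sub>R \<theta>) x))\<^sup>2)
        + (case z of (s, x) \<Rightarrow> \<bar>c s\<bar> * (b (dil (s *\<^sub>R 0) x))\<^sup>2))"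
      by (auto simp: split_beta)
  qed
qed

section \<open>Averages along the flow\<close>

lemma integrable_mult_L2:
  assumes [measurable]: "a \<in> borel_measurable M" "b \<in> borel_measurable M"
    and "integrable M (\<lambda>x. (a x)\<^sup>2)" "integrable M (\<lambda>x. (b x)\<^sup>2)"
  shows "integrable M (\<lambda>x. a x * b x :: real)"
proof (rule Bochner_Integration.integrable_bound)
  show "integrable M (\<lambda>x. (a x)\<^sup>2 + (b x)\<^sup>2)"
    using assms by simp
  show "AE x in M. norm (a x * b x) \<le> norm ((a x)\<^sup>2 + (b x)\<^sup>2)"
    using abs_mult_le_sum_squares by (intro AE_I2) simp
qed simp

lemma test_functions_integrable_power2:
  "f \<in> test_functions \<Longrightarrow> integrable orthant_volume (\<lambda>x. (f x)\<^sup>2)"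
  unfolding power2_eq_square by (intro test_functions_integrable test_functions_mult)

text \<open>\<open>p\<close> is the rate at which pulling back along the flow shrinks the weighted
  norm. In frame coefficients dilations preserve the norm, so this factor is carried
  explicitly.\<close>

definition decay :: "real \<Rightarrow> real \<Rightarrow> real" where
  "decay p s = indicator {0..} s * exp (- (p * s))"

lemma decay_nonneg: "0 \<le> decay p s"
  by (simp add: decay_def)

lemma decay_borel [measurable]: "decay p \<in> borel_measurable borel"
  unfolding decay_def[abs_def] by measurable

lemma has_bochner_integral_decay:
  assumes "0 < p"
  shows "has_bochner_integral lborel (decay p) (1 / p)"
proof (rule has_bochner_integral_nn_integral)
  have lim: "((\<lambda>s. - exp (- (p * s)) / p) \<longlongrightarrow> 0) at_top"
  proof -
    have "filterlim (\<lambda>s. - (p * s)) at_bot at_top"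
      using assms by (simp add: filterlim_uminus_at_bot filterlim_tendsto_pos_mult_at_top[OF tendsto_const] filterlim_ident)
    from filterlim_compose[OF exp_at_bot this] have "((\<lambda>s. exp (- (p * s))) \<longlongrightarrow> 0) at_top" .
    then have "((\<lambda>s. - exp (- (p * s)) / p) \<longlongrightarrow> - 0 / p) at_top"
      by (rule tendsto_divide[OF tendsto_minus tendsto_const]) (use assms in simp)
    then show ?thesis by simp
  qed
  have "(\<integral>\<^sup>+ s. ennreal (exp (- (p * s))) * indicator {0..} s \<partial>lborel) = ennreal (0 - (- exp (- (p * 0)) / p))"
    by (rule nn_integral_FTC_atLeast[OF _ _ _ lim])
       (use assms in \<open>auto intro!: derivative_eq_intros\<close>)
  moreover have "ennreal (decay p s) = ennreal (exp (- (p * s))) * indicator {0..} s" for s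
    by (simp add: decay_def split: split_indicator)
  ultimately show "(\<integral>\<^sup>+ s. ennreal (decay p s) \<partial>lborel) = ennreal (1 / p)"
    by simp
qed (use assms decay_nonneg in \<open>auto\<close>)

lemma integrable_decay: "0 < p \<Longrightarrow> integrable lborel (decay p)"
  and integral_decay: "0 < p \<Longrightarrow> (LINT s|lborel. decay p s) = 1 / p"
  using has_bochner_integral_decay by (auto simp: has_bochner_integral_iff)

definition flow_average :: "real \<Rightarrow> real ^ 'n \<Rightarrow> (real ^ 'n::finite \<Rightarrow> real) \<Rightarrow> real ^ 'n \<Rightarrow> real" where
  "flow_average p \<theta> a x = (LINT s|lborel. decay p s * a (dil (s *\<^sub>R \<theta>) x))"

lemma flow_average_borel [measurable]:
  assumes [measurable]: "a \<in> borel_measurable borel"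
  shows "flow_average p \<theta> a \<in> borel_measurable borel"
proof -
  have [measurable]: "(\<lambda>z. dil (snd z *\<^sub>R \<theta>) (fst z)) \<in> borel_measurable (borel \<Otimes>\<^sub>M borel)"
    using measurable_compose[OF measurable_pair_swap' flow_borel[of \<theta>]] by (simp add: split_beta)
  show ?thesis
    unfolding flow_average_def[abs_def]
    by (rule sigma_finite_measure.borel_measurable_lebesgue_integral[OF sigma_finite_lborel])
       (unfold split_beta, measurable)
qed

text \<open>Jensen's inequality for the probability density \<open>p * decay p\<close>.\<close>

lemma decay_average_power2_le:
  assumes p: "0 < p" and [measurable]: "f \<in> borel_measurable borel"
    and i2: "integrable lborel (\<lambda>s. decay p s * (f s)\<^sup>2)"
  shows "(LINT s|lborel. decay p s * f s)\<^sup>2 \<le> (LINT s|lborel. decay p s * (f s)\<^sup>2) / p"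
proof -
  have i1: "integrable lborel (\<lambda>s. decay p s * f s)"
  proof (rule Bochner_Integration.integrable_bound)
    show "integrable lborel (\<lambda>s. decay p s + decay p s * (f s)\<^sup>2)"
      using i2 integrable_decay[OF p] by simp
    have "\<bar>f s\<bar> \<le> 1 + (f s)\<^sup>2" for s
      using abs_mult_le_sum_squares[of 1 "f s"] by simp
    then have "\<bar>decay p s * f s\<bar> \<le> decay p s * (1 + (f s)\<^sup>2)" for s
      by (simp add: abs_mult decay_nonneg mult_left_mono)
    then show "AE s in lborel. norm (decay p s * f s) \<le> norm (decay p s + decay p s * (f s)\<^sup>2)"
      by (intro AE_I2) (simp add: distrib_left decay_nonneg)
  qed simp
  define w where "w = (LINT s|lborel. decay p s * f s)"
  \<comment> \<open>\<open>p * w\<close> is the mean of \<open>f\<close> for the probability density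
    in question; expanding the variance gives the claim.\<close>
  have "0 \<le> (LINT s|lborel. decay p s * (f s - p * w)\<^sup>2)"
    by (rule integral_nonneg_AE) (simp add: decay_nonneg)
  also have "\<dots> = (LINT s|lborel. decay p s * (f s)\<^sup>2 - (2 * p * w) * (decay p s * f s) + (p * w)\<^sup>2 * decay p s)"
    by (intro Bochner_Integration.integral_cong) (auto simp: power2_eq_square algebra_simps)
  also have "\<dots> = (LINT s|lborel. decay p s * (f s)\<^sup>2) - (2 * p * w) * w + (p * w)\<^sup>2 * (1 / p)"
    using i1 i2 integrable_decay[OF p] by (simp add: w_def integral_decay[OF p])
  also have "\<dots> = (LINT s|lborel. decay p s * (f s)\<^sup>2) - p * w\<^sup>2"
    using p by (simp add: power2_eq_square field_simps)
  finally show ?thesis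
    using p by (simp add: w_def field_simps)
qed

text \<open>Jensen's inequality along each orbit contributes one factor 1/p. After integration over
  space all time slices agree by invariance, and the integral of \<open>decay p\<close> contributes
  the other. The orbitwise bound holds almost everywhere, as Fubini gives integrability in s for
  almost every starting point only.\<close>

lemma flow_average_L2:
  assumes p: "0 < p" and [measurable]: "a \<in> borel_measurable borel"
    and a: "integrable orthant_volume (\<lambda>x. (a x)\<^sup>2)"
  shows "integrable orthant_volume (\<lambda>x. (flow_average p \<theta> a x)\<^sup>2)"
    and "(LINT x|orthant_volume. (flow_average p \<theta> a x)\<^sup>2) \<le> (LINT x|orthant_volume. (a x)\<^sup>2) / p\<^sup>2"
proof -
  interpret pair_sigma_finite lborel "orthant_volume :: (real ^ 'a) measure"
    by (rule pair_sigma_finite_orthant)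
  define B where "B x = (LINT s|lborel. decay p s * (a (dil (s *\<^sub>R \<theta>) x))\<^sup>2)" for x
  note int = flow_integrable[OF integrable_decay[OF p] a, of \<theta>]
  have [measurable]: "(\<lambda>s. dil (s *\<^sub>R \<theta>) x) \<in> borel_measurable borel" for x
    unfolding dil_def
    by (intro borel_measurable_continuous_onI continuous_intros)
  have le: "AE x in orthant_volume. (flow_average p \<theta> a x)\<^sup>2 \<le> B x / p"
    using AE_integrable_snd[OF int]
  proof eventually_elim
    case (elim x)
    show ?case
      unfolding flow_average_def B_def by (rule decay_average_power2_le[OF p _ elim]) measurable
  qed
  have B: "integrable orthant_volume B"
    unfolding B_def[abs_def] by (rule integrable_snd[OF int])
  have "(LINT x|orthant_volume. B x) = (LINT s|lborel. LINT x|orthant_volume. decay p s * (a (dil (s *\<^sub>R \<theta>) x))\<^sup>2)"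
    unfolding B_def by (rule Fubini_integral[OF int])
  also have "\<dots> = (LINT s|lborel. decay p s * (LINT x|orthant_volume. (a x)\<^sup>2))"
    by (simp add: integral_dil[of "\<lambda>x. (a x)\<^sup>2"])
  also have "\<dots> = (LINT x|orthant_volume. (a x)\<^sup>2) / p"
    by (simp add: integral_decay[OF p])
  finally have BI: "(LINT x|orthant_volume. B x) = (LINT x|orthant_volume. (a x)\<^sup>2) / p" .
  have Bp: "integrable orthant_volume (\<lambda>x. B x / p)"
    using B by simp
  show i: "integrable orthant_volume (\<lambda>x. (flow_average p \<theta> a x)\<^sup>2)"
  proof (rule Bochner_Integration.integrable_bound[OF Bp])
    show "(\<lambda>x. (flow_average p \<theta> a x)\<^sup>2) \<in> borel_measurable orthant_volume"
      by measurable
    show "AE x in orthant_volume. norm ((flow_average p \<theta> a x)\<^sup>2) \<le> norm (B x / p)"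
      using le
    proof eventually_elim
      case (elim x)
      then show ?case using abs_ge_self[of "B x / p"] by (simp only: real_norm_def abs_power2)
    qed
  qed
  have "(LINT x|orthant_volume. (flow_average p \<theta> a x)\<^sup>2) \<le> (LINT x|orthant_volume. B x / p)"
    by (rule integral_mono_AE[OF i Bp le])
  then show "(LINT x|orthant_volume. (flow_average p \<theta> a x)\<^sup>2) \<le> (LINT x|orthant_volume. (a x)\<^sup>2) / p\<^sup>2"
    using BI by (simp add: power2_eq_square)
qed

text \<open>Averages along \<theta> and - \<theta> are adjoint by invariance. Both pairings are
  expressed by the same integral over s of pairings with translates of \<psi>, because the
  translates are test functions while the average of \<psi> need not be.\<close>

lemma flow_average_adjoint:
  fixes a \<psi> :: "real ^ 'n::finite \<Rightarrow> real"
  assumes p: "0 < p" and [measurable]: "a \<in> borel_measurable borel"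
    and a: "integrable orthant_volume (\<lambda>x. (a x)\<^sup>2)" and \<psi>: "\<psi> \<in> test_functions"
  shows "integrable lborel (\<lambda>s. decay p s * (LINT x|orthant_volume. a x * \<psi> (dil (s *\<^sub>R - \<theta>) x)))"
    and "(LINT x|orthant_volume. flow_average p \<theta> a x * \<psi> x)
      = (LINT s|lborel. decay p s * (LINT x|orthant_volume. a x * \<psi> (dil (s *\<^sub>R - \<theta>) x)))"
    and "(LINT x|orthant_volume. a x * flow_average p (- \<theta>) \<psi> x)
      = (LINT s|lborel. decay p s * (LINT x|orthant_volume. a x * \<psi> (dil (s *\<^sub>R - \<theta>) x)))"
proof -
  interpret pair_sigma_finite lborel "orthant_volume :: (real ^ 'n) measure"
    by (rule pair_sigma_finite_orthant)
  have [measurable]: "\<psi> \<in> borel_measurable borel"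
    by (rule test_functions_borel[OF \<psi>])
  note \<psi>2 = test_functions_integrable_power2[OF \<psi>]
  note int = flow_pair_integrable[OF integrable_decay[OF p] _ _ a \<psi>2, of \<theta>, simplified]
  \<comment> \<open>Here \<open>a\<close> and \<open>\<psi>\<close> exchange roles, so that the flow
    acts on \<open>\<psi>\<close>, backwards.\<close>
  note int' = flow_pair_integrable[OF integrable_decay[OF p] _ _ \<psi>2 a, of "- \<theta>", simplified]
  have inv: "(LINT x|orthant_volume. a (dil (s *\<^sub>R \<theta>) x) * \<psi> x)
      = (LINT x|orthant_volume. a x * \<psi> (dil (s *\<^sub>R - \<theta>) x))" for s
    using integral_dil[of "\<lambda>x. a x * \<psi> (dil (s *\<^sub>R - \<theta>) x)" "s *\<^sub>R \<theta>"]
    by (simp add: dil_dil)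
  have 1: "(LINT x|orthant_volume. decay p s * a (dil (s *\<^sub>R \<theta>) x) * \<psi> x)
      = decay p s * (LINT x|orthant_volume. a x * \<psi> (dil (s *\<^sub>R - \<theta>) x))" for s
    unfolding inv[symmetric] by (simp add: mult.assoc)
  have 2: "(LINT x|orthant_volume. decay p s * \<psi> (dil (s *\<^sub>R - \<theta>) x) * a x)
      = decay p s * (LINT x|orthant_volume. a x * \<psi> (dil (s *\<^sub>R - \<theta>) x))" for s
    by (simp add: mult.assoc mult.commute[of "a _"])
  show "integrable lborel (\<lambda>s. decay p s * (LINT x|orthant_volume. a x * \<psi> (dil (s *\<^sub>R - \<theta>) x)))"
    using integrable_fst[OF int] unfolding 1 .
  show "(LINT x|orthant_volume. flow_average p \<theta> a x * \<psi> x)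
      = (LINT s|lborel. decay p s * (LINT x|orthant_volume. a x * \<psi> (dil (s *\<^sub>R - \<theta>) x)))"
    using Fubini_integral[OF int] unfolding 1 by (simp add: flow_average_def)
  show "(LINT x|orthant_volume. a x * flow_average p (- \<theta>) \<psi> x)
      = (LINT s|lborel. decay p s * (LINT x|orthant_volume. a x * \<psi> (dil (s *\<^sub>R - \<theta>) x)))"
    using Fubini_integral[OF int'] 2 by (simp add: flow_average_def mult.commute[of "a _"])
qed

lemma integral_atLeast_derivative:
  fixes F f :: "real \<Rightarrow> real"
  assumes der: "\<And>s. (F has_real_derivative f s) (at s)" and cont: "continuous_on UNIV f"
    and S: "0 \<le> S" and vanish: "\<And>s. S \<le> s \<Longrightarrow> F s = 0"
  shows "(LINT s|lborel. indicator {0..} s * f s) = - F 0"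
proof -
  have f0: "f s = 0" if "S < s" for s
  proof -
    have "((\<lambda>_. 0) has_real_derivative 0) (at s)" by simp
    then have "(F has_real_derivative 0) (at s)"
      by (rule has_field_derivative_transform_within_open[where S = "{S<..}"])
         (use that vanish in auto)
    then show ?thesis using DERIV_unique der by blast
  qed
  have "(LINT s|lborel. indicator {0..} s * f s) = (LINT s|lborel. f s * indicator {0..S} s)"
    by (intro Bochner_Integration.integral_cong) (auto simp: f0 split: split_indicator)
  also have "\<dots> = F S - F 0"
    using cont S der by (intro integral_FTC_Icc_real) (auto simp: continuous_on_eq_continuous_at)
  finally show ?thesis using vanish[of S] by simp
qed

text \<open>The integrand is minus the s-derivative of exp (- p s) f (dil (- s \<theta>) x).
  Infinity contributes nothing, because the backward flow drives coordinate \<open>j\<close> to 0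
  and so leaves the compact support. Averaging thus inverts p plus the generator of the flow on test
  functions.\<close>

lemma flow_average_generator:
  assumes f: "f \<in> test_functions" and \<theta>: "0 < \<theta> $ j"
  shows "flow_average p (- \<theta>) (\<lambda>x. p * f x + (\<Sum>i\<in>UNIV. \<theta> $ i * log_deriv i f x)) x = f x"
proof -
  let ?g = "\<lambda>x. p * f x + (\<Sum>i\<in>UNIV. \<theta> $ i * log_deriv i f x)"
  let ?F = "\<lambda>s. - (exp (- (p * s)) * f (dil (s *\<^sub>R - \<theta>) x))"
  obtain K where K: "compact K" "K \<subseteq> orthant" "\<forall>x. x \<notin> K \<longrightarrow> f x = 0"
    using test_functions_support[OF f] by blast
  \<comment> \<open>A positive lower bound for coordinate \<open>j\<close> on the support; for empty
    \<open>K\<close> any positive number serves.\<close>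
  obtain l where l: "0 < l" "\<forall>y\<in>K. l \<le> y $ j"
  proof (cases "K = {}")
    case False
    have "continuous_on K (\<lambda>y. y $ j)" by (intro continuous_intros)
    then obtain y where "y \<in> K" "\<forall>z\<in>K. y $ j \<le> z $ j"
      using continuous_attains_inf[OF K(1) False] by blast
    moreover have "0 < y $ j" using K(2) \<open>y \<in> K\<close> by (auto simp: orthant_def)
    ultimately show thesis using that by blast
  qed (use that[of 1] in simp)
  obtain S where S: "0 \<le> S" "\<And>s. S \<le> s \<Longrightarrow> exp (- (s * \<theta> $ j)) * x $ j < l"
  proof
    \<comment> \<open>From this time on, exp (s \<theta>_j) is at least (|x_j| + 1) / l. The summand
      1 keeps the logarithm's argument positive and makes the final inequality strict; the absolute
      value is there because \<open>x\<close> may lie outside the orthant.\<close>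
    let ?S = "max 0 (ln ((\<bar>x $ j\<bar> + 1) / l) / \<theta> $ j)"
    show "0 \<le> ?S" by simp
    fix s assume s: "?S \<le> s"
    then have "ln ((\<bar>x $ j\<bar> + 1) / l) \<le> s * \<theta> $ j" using \<theta> by (simp add: field_simps)
    then have "exp (ln ((\<bar>x $ j\<bar> + 1) / l)) \<le> exp (s * \<theta> $ j)"
      by simp
    moreover have "0 < (\<bar>x $ j\<bar> + 1) / l" using l(1) by simp
    ultimately have "(\<bar>x $ j\<bar> + 1) / l \<le> exp (s * \<theta> $ j)"
      by (simp only: exp_ln)
    then have "\<bar>x $ j\<bar> + 1 \<le> exp (s * \<theta> $ j) * l" using l(1) by (simp add: field_simps)
    then have "x $ j < exp (s * \<theta> $ j) * l" by linarith
    then show "exp (- (s * \<theta> $ j)) * x $ j < l" by (simp add: exp_minus field_simps)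
  qed
  have g: "?g \<in> test_functions"
    by (intro test_functions_add test_functions_cmult test_functions_sum log_deriv_test f)
  have "(LINT s|lborel. indicator {0..} s * (exp (- (p * s)) * ?g (dil (s *\<^sub>R - \<theta>) x))) = - ?F 0"
  proof (rule integral_atLeast_derivative[OF _ _ S(1)])
    show "(?F has_real_derivative exp (- (p * s)) * ?g (dil (s *\<^sub>R - \<theta>) x)) (at s)" for s
      by (rule derivative_eq_intros flow_has_derivative[OF f] refl)+
         (simp add: algebra_simps sum_negf)
    show "continuous_on UNIV (\<lambda>s. exp (- (p * s)) * ?g (dil (s *\<^sub>R - \<theta>) x))"
      by (intro continuous_intros continuous_on_flow[OF test_functions_continuous[OF g]])
    show "?F s = 0" if "S \<le> s" for s
    proof -
      have "dil (s *\<^sub>R - \<theta>) x \<notin> K"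
      proof
        assume "dil (s *\<^sub>R - \<theta>) x \<in> K"
        then have "l \<le> dil (s *\<^sub>R - \<theta>) x $ j" using l(2) by blast
        then show False using S(2)[OF that] by simp
      qed
      then show ?thesis using K(3) by simp
    qed
  qed
  then show ?thesis by (simp add: flow_average_def decay_def mult.assoc)
qed

text \<open>Integrating the logarithmic derivative along the flow for unit time gives the difference
  of a translate of \<open>f\<close> and \<open>f\<close>, whose integral is 0 by invariance. By
  Fubini this is also the time integral of the integrals of translates of the logarithmic
  derivative, which are all equal.\<close>

lemma integral_log_deriv_eq_0:
  fixes f :: "real ^ 'n::finite \<Rightarrow> real"
  assumes f: "f \<in> test_functions"
  shows "(LINT x|orthant_volume. log_deriv i f x) = 0"
proof -
  interpret pair_sigma_finite lborel "orthant_volume :: (real ^ 'n) measure"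
    by (rule pair_sigma_finite_orthant)
  let ?\<theta> = "axis i 1 :: real ^ 'n"
  let ?c = "indicator {0..1} :: real \<Rightarrow> real"
  have g: "log_deriv i f \<in> test_functions" by (rule log_deriv_test[OF f])
  have "integrable lborel ?c" by (simp add: integrable_indicator_iff)
  note int = flow_integrable[OF this test_functions_integrable[OF g], of ?\<theta>]
  have der: "((\<lambda>s. f (dil (s *\<^sub>R ?\<theta>) x)) has_real_derivative log_deriv i f (dil (s *\<^sub>R ?\<theta>) x)) (at s)" for s x
    using flow_has_derivative[OF f, of ?\<theta> x s] by (simp add: axis_def if_distrib[of "\<lambda>t. t * _"] cong: if_cong)
  have "isCont (\<lambda>s. log_deriv i f (dil (s *\<^sub>R ?\<theta>) x)) s" for s x
    using continuous_on_flow[OF test_functions_continuous[OF g]] continuous_on_eq_continuous_at[OF open_UNIV] by blast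
  then have "(LINT s|lborel. log_deriv i f (dil (s *\<^sub>R ?\<theta>) x) * ?c s) = f (dil (1 *\<^sub>R ?\<theta>) x) - f (dil (0 *\<^sub>R ?\<theta>) x)" for x
    by (intro integral_FTC_Icc_real der) auto
  then have "(LINT x|orthant_volume. LINT s|lborel. ?c s * log_deriv i f (dil (s *\<^sub>R ?\<theta>) x))
      = (LINT x|orthant_volume. f (dil ?\<theta> x) - f x)"
    by (simp add: mult.commute)
  also have "\<dots> = 0"
    using test_functions_integrable[OF f] test_functions_integrable[OF test_functions_dil[OF f]]
      integral_dil[OF test_functions_borel[OF f]] by simp
  finally have "(LINT s|lborel. LINT x|orthant_volume. ?c s * log_deriv i f (dil (s *\<^sub>R ?\<theta>) x)) = 0"
    using Fubini_integral[OF int] by simp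
  then show ?thesis
    by (simp add: integral_dil[OF test_functions_borel[OF g]])
qed

section \<open>The homotopy operator\<close>

text \<open>
  \<open>ext i\<close> is exterior multiplication by the \<open>i\<close>-th covector, \<open>ctr i\<close> is contraction with the
  \<open>i\<close>-th vector, acting on the coefficients of a form.
\<close>

definition wsign :: "'n::linorder \<Rightarrow> 'n set \<Rightarrow> real" where
  "wsign i J = (- 1) ^ card {k \<in> J. k < i}"

definition ext :: "'n::linorder \<Rightarrow> ('n set \<Rightarrow> real) \<Rightarrow> 'n set \<Rightarrow> real" where
  "ext i b K = (if i \<in> K then wsign i K * b (K - {i}) else 0)"

definition ctr :: "'n::linorder \<Rightarrow> ('n set \<Rightarrow> real) \<Rightarrow> 'n set \<Rightarrow> real" where
  "ctr i b J = (if i \<in> J then 0 else wsign i J * b (insert i J))"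

lemma wsign_square [simp]: "wsign i J * wsign i J = 1"
  by (simp add: wsign_def power_mult_distrib[symmetric])

lemma wsign_insert:
  fixes i j :: "'n::{finite,linorder}"
  assumes "j \<notin> J"
  shows "wsign i (insert j J) = (if j < i then - wsign i J else wsign i J)"
proof (cases "j < i")
  case True
  then have "{k \<in> insert j J. k < i} = insert j {k \<in> J. k < i}" by auto
  then show ?thesis using assms True by (simp add: wsign_def)
next
  case False
  then have "{k \<in> insert j J. k < i} = {k \<in> J. k < i}" by auto
  then show ?thesis using False by (simp add: wsign_def)
qed

lemma wsign_remove:
  fixes i j :: "'n::{finite,linorder}"
  assumes "j \<in> J"
  shows "wsign i (J - {j}) = (if j < i then - wsign i J else wsign i J)"
  using wsign_insert[of j "J - {j}" i] insert_Diff[OF assms] by auto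

text \<open>The Clifford relation of an orthonormal basis. For i = j exactly one summand can be
  nonzero and its two signs multiply to 1. For i \<noteq> j the only case with nonzero terms has j
  in J and i outside: removing j flips the sign of i iff j < i, adding i flips the sign of j iff i <
  j, and exactly one of these happens.\<close>

lemma ext_ctr_anticommute:
  fixes i j :: "'n::{finite,linorder}"
  shows "ext j (ctr i b) J + ctr i (ext j b) J = (if i = j then b J else 0)"
proof (cases "i = j")
  case True
  then show ?thesis
    by (auto simp: ext_def ctr_def wsign_remove wsign_insert insert_absorb mult.assoc[symmetric])
next
  case False
  consider "i \<in> J" | "i \<notin> J" "j \<notin> J" | "i \<notin> J" "j \<in> J" by blast
  then show ?thesis
  proof cases
    case 3
    then have "insert i J - {j} = insert i (J - {j})" using False by auto
    then have "ext j (ctr i b) J = wsign j J * (wsign i (J - {j}) * b (insert i (J - {j})))"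
      "ctr i (ext j b) J = wsign i J * (wsign j (insert i J) * b (insert i (J - {j})))"
      using 3 by (simp_all add: ext_def ctr_def)
    then show ?thesis
      using False by (cases i j rule: linorder_cases) (simp_all add: wsign_remove[OF 3(2)] wsign_insert[OF 3(1)])
  qed (use False in \<open>auto simp: ext_def ctr_def\<close>)
qed

text \<open>Removing i is a bijection from the index sets with i to those without, and it leaves the
  sign of i unchanged.\<close>

lemma sum_ext_eq_sum_ctr:
  fixes i :: "'n::{finite,linorder}"
  shows "(\<Sum>K\<in>UNIV. ext i a K * b K) = (\<Sum>J\<in>UNIV. a J * ctr i b J)"
proof -
  have "(\<Sum>K\<in>UNIV. ext i a K * b K) = (\<Sum>K\<in>{K. i \<in> K}. wsign i K * a (K - {i}) * b K)"
    by (rule sum.mono_neutral_cong_right) (auto simp: ext_def)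
  also have "\<dots> = (\<Sum>J\<in>{J. i \<notin> J}. a J * (wsign i J * b (insert i J)))"
    by (rule sum.reindex_bij_witness[of _ "insert i" "\<lambda>K. K - {i}"])
       (auto simp: insert_absorb wsign_remove)
  also have "\<dots> = (\<Sum>J\<in>UNIV. a J * ctr i b J)"
    by (rule sum.mono_neutral_cong_left) (auto simp: ctr_def)
  finally show ?thesis .
qed

lemma ext_add: "ext i (\<lambda>J. a J + b J) K = ext i a K + ext i b K"
  by (simp add: ext_def distrib_left)

lemma ctr_add: "ctr i (\<lambda>J. a J + b J) K = ctr i a K + ctr i b K"
  by (simp add: ctr_def distrib_left)

lemma ext_uminus: "ext i (\<lambda>J. - a J) K = - ext i a K"
  by (simp add: ext_def)

lemma ext_zero [simp]: "ext i (\<lambda>J. 0) K = 0"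
  by (simp add: ext_def)

lemma ext_sum: "ext i (\<lambda>J. \<Sum>j\<in>A. a j J) K = (\<Sum>j\<in>A. ext i (a j) K)"
  by (simp add: ext_def sum_distrib_left)

lemma ctr_sum: "ctr i (\<lambda>J. \<Sum>j\<in>A. a j J) K = (\<Sum>j\<in>A. ctr i (a j) K)"
  by (simp add: ctr_def sum_distrib_left)

section \<open>Wedge product with the dual covector of X and contraction with X\<close>

definition ext_on :: "'n::linorder set \<Rightarrow> ('n set \<Rightarrow> real) \<Rightarrow> 'n set \<Rightarrow> real" where
  "ext_on I b K = (\<Sum>i\<in>I. ext i b K)"

definition ctr_on :: "'n::linorder set \<Rightarrow> ('n set \<Rightarrow> real) \<Rightarrow> 'n set \<Rightarrow> real" where
  "ctr_on I b K = (\<Sum>i\<in>I. ctr i b K)"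

lemma sum_ext_on_eq_sum_ctr_on:
  fixes I :: "'n::{finite,linorder} set"
  shows "(\<Sum>K\<in>UNIV. ext_on I a K * b K) = (\<Sum>J\<in>UNIV. a J * ctr_on I b J)"
proof -
  have "(\<Sum>K\<in>UNIV. ext_on I a K * b K) = (\<Sum>i\<in>I. \<Sum>K\<in>UNIV. ext i a K * b K)"
    unfolding ext_on_def sum_distrib_right by (rule sum.swap)
  also have "\<dots> = (\<Sum>i\<in>I. \<Sum>J\<in>UNIV. a J * ctr i b J)"
    by (simp only: sum_ext_eq_sum_ctr)
  also have "\<dots> = (\<Sum>J\<in>UNIV. a J * ctr_on I b J)"
    unfolding ctr_on_def sum_distrib_left by (rule sum.swap)
  finally show ?thesis .
qed

lemma ext_on_ctr_on_anticommute:
  fixes I :: "'n::{finite,linorder} set" and b :: "'n set \<Rightarrow> real"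
  shows "ext_on I (ctr_on I b) J + ctr_on I (ext_on I b) J = card I * b J"
proof -
  have "ext_on I (ctr_on I b) J = (\<Sum>j\<in>I. \<Sum>i\<in>I. ext j (ctr i b) J)"
    by (simp add: ext_on_def ctr_on_def[abs_def] ext_sum)
  moreover have "ctr_on I (ext_on I b) J = (\<Sum>j\<in>I. \<Sum>i\<in>I. ctr i (ext j b) J)"
    by (subst sum.swap) (simp add: ext_on_def[abs_def] ctr_on_def ctr_sum)
  ultimately have "ext_on I (ctr_on I b) J + ctr_on I (ext_on I b) J
      = (\<Sum>j\<in>I. \<Sum>i\<in>I. if i = j then b J else 0)"
    by (simp add: sum.distrib[symmetric] ext_ctr_anticommute)
  then show ?thesis by simp
qed

text \<open>Pairing the anticommutation relation with \<open>b\<close> shows that contraction and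
  wedge product together have squared norm |X|^2 |b|^2, where |X|^2 = card I; the wedge product is
  then dropped.\<close>

lemma sum_ctr_on_power2_le:
  fixes I :: "'n::{finite,linorder} set" and b :: "'n set \<Rightarrow> real"
  shows "(\<Sum>J\<in>UNIV. (ctr_on I b J)\<^sup>2) \<le> card I * (\<Sum>J\<in>UNIV. (b J)\<^sup>2)"
proof -
  have "(\<Sum>J\<in>UNIV. (ctr_on I b J)\<^sup>2) = (\<Sum>J\<in>UNIV. ext_on I (ctr_on I b) J * b J)"
    by (simp add: sum_ext_on_eq_sum_ctr_on power2_eq_square)
  moreover have "(\<Sum>J\<in>UNIV. (ext_on I b J)\<^sup>2) = (\<Sum>J\<in>UNIV. ctr_on I (ext_on I b) J * b J)"
    using sum_ext_on_eq_sum_ctr_on[of I b "ext_on I b"] by (simp add: power2_eq_square mult.commute)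
  ultimately have "(\<Sum>J\<in>UNIV. (ctr_on I b J)\<^sup>2) + (\<Sum>J\<in>UNIV. (ext_on I b J)\<^sup>2)
      = (\<Sum>J\<in>UNIV. (ext_on I (ctr_on I b) J + ctr_on I (ext_on I b) J) * b J)"
    by (simp add: sum.distrib distrib_right)
  also have "\<dots> = card I * (\<Sum>J\<in>UNIV. (b J)\<^sup>2)"
    unfolding ext_on_ctr_on_anticommute by (simp add: sum_distrib_left power2_eq_square mult.assoc)
  finally show ?thesis
    using sum_nonneg[of UNIV "\<lambda>J. (ext_on I b J)\<^sup>2"] by simp
qed

text \<open>
  In the orthonormal frame \<open>dx\<^sup>i / x\<^sup>i\<close> the component \<open>I\<close> of \<open>dbar\<close> becomes
  \<open>twisted_d I\<close>, the exterior derivative in the coordinates \<open>ln x\<^sup>i\<close> conjugated with the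
  weight \<open>\<Prod>i\<in>I. x\<^sup>i\<close>; its formal adjoint is \<open>twisted_delta I\<close>.
\<close>

definition twisted_d ::
    "'n::{finite,linorder} set \<Rightarrow> ('n set \<Rightarrow> real ^ ('n::{finite,linorder}) \<Rightarrow> real) \<Rightarrow> 'n set \<Rightarrow> real ^ ('n::{finite,linorder}) \<Rightarrow> real" where
  "twisted_d I \<alpha> K x =
     (\<Sum>i\<in>UNIV. ext i (\<lambda>J. log_deriv i (\<alpha> J) x - (if i \<in> I then \<alpha> J x else 0)) K)"

definition twisted_delta ::
    "'n::{finite,linorder} set \<Rightarrow> ('n set \<Rightarrow> real ^ ('n::{finite,linorder}) \<Rightarrow> real) \<Rightarrow> 'n set \<Rightarrow> real ^ ('n::{finite,linorder}) \<Rightarrow> real" where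
  "twisted_delta I \<psi> J x =
     - (\<Sum>i\<in>UNIV. ctr i (\<lambda>K. log_deriv i (\<psi> K) x + (if i \<in> I then \<psi> K x else 0)) J)"

lemma ext_test:
  "(\<And>J. \<psi> J \<in> test_functions) \<Longrightarrow> (\<lambda>x. ext i (\<lambda>J. \<psi> J x) K) \<in> test_functions"
  by (cases "i \<in> K") (simp_all add: ext_def test_functions_0 test_functions_cmult)

lemma ctr_test:
  "(\<And>J. \<psi> J \<in> test_functions) \<Longrightarrow> (\<lambda>x. ctr i (\<lambda>J. \<psi> J x) K) \<in> test_functions"
  by (cases "i \<in> K") (simp_all add: ctr_def test_functions_0 test_functions_cmult)

lemma twisted_delta_test:
  assumes "\<And>J. \<psi> J \<in> test_functions"
  shows "twisted_delta I \<psi> J \<in> test_functions"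
proof -
  have "(\<lambda>x. log_deriv i (\<psi> K) x + (if i \<in> I then \<psi> K x else 0)) \<in> test_functions" for i K
    using assms by (cases "i \<in> I") (auto intro!: test_functions_add log_deriv_test)
  then have "(\<lambda>x. (- 1) * (\<Sum>i\<in>UNIV. ctr i (\<lambda>K. log_deriv i (\<psi> K) x + (if i \<in> I then \<psi> K x else 0)) J)) \<in> test_functions"
    by (intro test_functions_cmult test_functions_sum ctr_test)
  then show ?thesis
    by (simp add: twisted_delta_def[abs_def])
qed

lemma log_deriv_ctr:
  assumes "\<And>J. \<psi> J \<in> test_functions"
  shows "log_deriv i (\<lambda>x. ctr j (\<lambda>J. \<psi> J x) K) x = ctr j (\<lambda>J. log_deriv i (\<psi> J) x) K"
  using assms by (simp add: ctr_def log_deriv_cmult log_deriv_const test_functions_differentiable)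

lemma log_deriv_ext:
  assumes "\<And>J. \<psi> J \<in> test_functions"
  shows "log_deriv i (\<lambda>x. ext j (\<lambda>J. \<psi> J x) K) x = ext j (\<lambda>J. log_deriv i (\<psi> J) x) K"
  using assms by (simp add: ext_def log_deriv_cmult log_deriv_const test_functions_differentiable)

lemma log_deriv_sum:
  assumes "\<And>j. j \<in> A \<Longrightarrow> f j \<in> test_functions"
  shows "log_deriv i (\<lambda>x. \<Sum>j\<in>A. f j x) x = (\<Sum>j\<in>A. log_deriv i (f j) x)"
  using assms
proof (induction A rule: infinite_finite_induct)
  case (insert a A)
  then show ?case
    by (simp add: log_deriv_add test_functions_differentiable test_functions_sum)
qed (simp_all add: log_deriv_const)

lemma log_deriv_ext_on:
  assumes "\<And>J. \<psi> J \<in> test_functions"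
  shows "log_deriv i (\<lambda>x. ext_on I (\<lambda>J. \<psi> J x) K) x = ext_on I (\<lambda>J. log_deriv i (\<psi> J) x) K"
  using assms by (simp add: ext_on_def log_deriv_sum ext_test log_deriv_ext)

text \<open>The integrands differ by a sum of logarithmic derivatives of test functions, which
  integrate to 0. The zeroth-order terms agree exactly, since the outer minus sign of
  \<open>twisted_delta\<close> turns its plus into the minus of \<open>twisted_d\<close>.\<close>

lemma integration_by_parts:
  fixes \<alpha> \<psi> :: "'n::{finite,linorder} set \<Rightarrow> real ^ ('n::{finite,linorder}) \<Rightarrow> real"
  assumes \<alpha>: "\<And>J. \<alpha> J \<in> test_functions" and \<psi>: "\<And>J. \<psi> J \<in> test_functions"
  shows "(LINT x|orthant_volume. (\<Sum>K\<in>UNIV. twisted_d I \<alpha> K x * \<psi> K x))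
       = (LINT x|orthant_volume. (\<Sum>J\<in>UNIV. \<alpha> J x * twisted_delta I \<psi> J x))"
proof -
  define c where "c i J x = ctr i (\<lambda>K. \<psi> K x) J" for i J and x :: "real ^ ('n::{finite,linorder})"
  have c: "c i J \<in> test_functions" for i J
    unfolding c_def[abs_def] by (rule ctr_test[OF \<psi>])
  have ac: "(\<lambda>x. \<alpha> J x * c i J x) \<in> test_functions" for i J
    by (rule test_functions_mult[OF \<alpha> c])
  have d: "(\<Sum>K\<in>UNIV. twisted_d I \<alpha> K x * \<psi> K x)
      = (\<Sum>i\<in>UNIV. \<Sum>J\<in>UNIV. (log_deriv i (\<alpha> J) x - (if i \<in> I then \<alpha> J x else 0)) * c i J x)" for x
  proof -
    have "(\<Sum>K\<in>UNIV. twisted_d I \<alpha> K x * \<psi> K x)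
      = (\<Sum>i\<in>UNIV. \<Sum>K\<in>UNIV. ext i (\<lambda>J. log_deriv i (\<alpha> J) x - (if i \<in> I then \<alpha> J x else 0)) K * \<psi> K x)"
      unfolding twisted_d_def sum_distrib_right by (rule sum.swap)
    then show ?thesis by (simp only: sum_ext_eq_sum_ctr c_def)
  qed
  have \<delta>: "(\<Sum>J\<in>UNIV. \<alpha> J x * twisted_delta I \<psi> J x)
      = - (\<Sum>i\<in>UNIV. \<Sum>J\<in>UNIV. \<alpha> J x * (log_deriv i (c i J) x + (if i \<in> I then c i J x else 0)))" for x
  proof -
    have "ctr i (\<lambda>K. log_deriv i (\<psi> K) x + (if i \<in> I then \<psi> K x else 0)) J
        = log_deriv i (c i J) x + (if i \<in> I then c i J x else 0)" for i J
      by (simp add: ctr_add c_def[abs_def] log_deriv_ctr[OF \<psi>]) (simp add: ctr_def)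
    then have "(\<Sum>J\<in>UNIV. \<alpha> J x * twisted_delta I \<psi> J x)
        = - (\<Sum>J\<in>UNIV. \<Sum>i\<in>UNIV. \<alpha> J x * (log_deriv i (c i J) x + (if i \<in> I then c i J x else 0)))"
      by (simp add: twisted_delta_def sum_negf sum_distrib_left)
    also have "\<dots> = - (\<Sum>i\<in>UNIV. \<Sum>J\<in>UNIV. \<alpha> J x * (log_deriv i (c i J) x + (if i \<in> I then c i J x else 0)))"
      by (rule arg_cong[OF sum.swap])
    finally show ?thesis .
  qed
  have "(\<Sum>K\<in>UNIV. twisted_d I \<alpha> K x * \<psi> K x)
      = (\<Sum>J\<in>UNIV. \<alpha> J x * twisted_delta I \<psi> J x)
        + (\<Sum>i\<in>UNIV. \<Sum>J\<in>UNIV. log_deriv i (\<lambda>x. \<alpha> J x * c i J x) x)" for x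
    unfolding d \<delta> using \<alpha> c
    by (simp add: log_deriv_mult test_functions_differentiable sum_subtractf[symmetric] sum_negf[symmetric]
        sum.distrib[symmetric] algebra_simps)
       (auto intro!: sum.cong)
  moreover have "integrable orthant_volume (\<lambda>x. \<Sum>J\<in>UNIV. \<alpha> J x * twisted_delta I \<psi> J x)"
    by (intro test_functions_integrable test_functions_sum test_functions_mult \<alpha> twisted_delta_test \<psi>)
  moreover have "integrable orthant_volume (\<lambda>x. log_deriv i (\<lambda>x. \<alpha> J x * c i J x) x)" for i J
    by (intro test_functions_integrable log_deriv_test ac)
  ultimately show ?thesis
    by (simp add: integral_log_deriv_eq_0[OF ac])
qed

text \<open>Cartan's formula for the adjoints, the vector field being the sum of the \<open>x\<^sup>i \<partial>\<^sub>i\<close>, \<open>i \<in> I\<close>.\<close>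

lemma twisted_cartan:
  fixes \<psi> :: "'n::{finite,linorder} set \<Rightarrow> real ^ ('n::{finite,linorder}) \<Rightarrow> real"
  assumes \<psi>: "\<And>J. \<psi> J \<in> test_functions"
  shows "ext_on I (\<lambda>K. twisted_delta I \<psi> K x) J
       + twisted_delta I (\<lambda>K x. ext_on I (\<lambda>J. \<psi> J x) K) J x
       = - (real (card I) * \<psi> J x + (\<Sum>i\<in>I. log_deriv i (\<psi> J) x))"
proof -
  define D where "D i K = log_deriv i (\<psi> K) x + (if i \<in> I then \<psi> K x else 0)" for i K
  have "log_deriv i (\<lambda>x. ext_on I (\<lambda>J. \<psi> J x) K) x + (if i \<in> I then ext_on I (\<lambda>J. \<psi> J x) K else 0)
      = (\<Sum>j\<in>I. ext j (D i) K)" for i K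
    unfolding log_deriv_ext_on[OF \<psi>] D_def[abs_def]
    by (auto simp: ext_on_def ext_add sum.distrib)
  then have 1: "twisted_delta I (\<lambda>K x. ext_on I (\<lambda>J. \<psi> J x) K) J x = - (\<Sum>j\<in>I. \<Sum>i\<in>UNIV. ctr i (ext j (D i)) J)"
    unfolding twisted_delta_def by (subst sum.swap) (simp add: ctr_sum)
  have 2: "ext_on I (\<lambda>K. twisted_delta I \<psi> K x) J = - (\<Sum>j\<in>I. \<Sum>i\<in>UNIV. ext j (ctr i (D i)) J)"
    unfolding twisted_delta_def D_def[abs_def] by (simp add: ext_on_def ext_uminus ext_sum sum_negf)
  \<comment> \<open>Anticommutation leaves the terms with i = j. As these j lie in \<open>I\<close>,
    each contributes \<psi> once through the zeroth-order part of \<open>D\<close>, which produces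
    the term with card I.\<close>
  have "ext_on I (\<lambda>K. twisted_delta I \<psi> K x) J + twisted_delta I (\<lambda>K x. ext_on I (\<lambda>J. \<psi> J x) K) J x
      = - (\<Sum>j\<in>I. \<Sum>i\<in>UNIV. if i = j then D i J else 0)"
    unfolding 1 2 by (simp add: ext_ctr_anticommute[symmetric] sum.distrib)
  also have "\<dots> = - (\<Sum>j\<in>I. D j J)"
    by simp
  also have "(\<Sum>j\<in>I. D j J) = (\<Sum>j\<in>I. \<psi> J x + log_deriv j (\<psi> J) x)"
    by (intro sum.cong) (auto simp: D_def)
  finally show ?thesis by (simp add: sum.distrib)
qed

lemma twisted_delta_dil:
  assumes "\<And>J. \<psi> J \<in> test_functions"
  shows "twisted_delta I (\<lambda>J x. \<psi> J (dil y x)) J x = twisted_delta I \<psi> J (dil y x)"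
  by (simp add: twisted_delta_def log_deriv_dil[OF assms])

text \<open>X is constant in logarithmic coordinates and this is its coordinate vector; the
  dilations by its multiples are the flow of X.\<close>

definition indic_vec :: "'n set \<Rightarrow> real ^ 'n::finite" where
  "indic_vec I = (\<chi> i. if i \<in> I then 1 else 0)"

text \<open>The integral of the overview in frame coefficients, for one fixed I. For closed v the
  s-derivative of the pulled back form is d of its contraction; integrated over s \<ge> 0 it gives
  the limit 0 at infinity minus v, whence the sign.\<close>

definition homotopy ::
    "'n::{finite,linorder} set \<Rightarrow> ('n set \<Rightarrow> real ^ ('n::{finite,linorder}) \<Rightarrow> real) \<Rightarrow> 'n set \<Rightarrow> real ^ ('n::{finite,linorder}) \<Rightarrow> real" where
  "homotopy I v J x = - flow_average (real (card I)) (indic_vec I) (\<lambda>x. ctr_on I (\<lambda>K. v K x) J) x"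

lemma ctr_on_borel [measurable]:
  assumes [measurable]: "\<And>K. v K \<in> borel_measurable M"
  shows "(\<lambda>x. ctr_on I (\<lambda>K. v K x) J) \<in> borel_measurable M"
  unfolding ctr_on_def ctr_def by measurable

lemma ctr_on_L2:
  fixes v :: "'n::{finite,linorder} set \<Rightarrow> 'a \<Rightarrow> real"
  assumes [measurable]: "\<And>K. v K \<in> borel_measurable M"
    and "\<And>K. integrable M (\<lambda>x. (v K x)\<^sup>2)"
  shows "integrable M (\<lambda>x. (ctr_on I (\<lambda>K. v K x) J)\<^sup>2)"
proof (rule Bochner_Integration.integrable_bound)
  show "integrable M (\<lambda>x. card I * (\<Sum>K\<in>UNIV. (v K x)\<^sup>2))"
    using assms(2) by simp
  have "(ctr_on I b J)\<^sup>2 \<le> card I * (\<Sum>K\<in>UNIV. (b K)\<^sup>2)" for b :: "'n set \<Rightarrow> real"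
    using member_le_sum[of J UNIV "\<lambda>J. (ctr_on I b J)\<^sup>2"] sum_ctr_on_power2_le[of I b] by simp
  then show "AE x in M. norm ((ctr_on I (\<lambda>K. v K x) J)\<^sup>2) \<le> norm (card I * (\<Sum>K\<in>UNIV. (v K x)\<^sup>2))"
    by (intro AE_I2) (simp add: sum_nonneg)
qed simp

text \<open>On squared norms averaging costs 1 / (card I)^2 and contraction costs card I. What is
  left, 1 / card I, is the square of the constant in the theorem when card I = p.\<close>

lemma homotopy_L2:
  fixes v :: "'n::{finite,linorder} set \<Rightarrow> real ^ ('n::{finite,linorder}) \<Rightarrow> real"
  assumes I: "I \<noteq> {}" and v [measurable]: "\<And>K. v K \<in> borel_measurable borel"
    and v2: "\<And>K. integrable orthant_volume (\<lambda>x. (v K x)\<^sup>2)"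
  shows "homotopy I v J \<in> borel_measurable borel"
    and "integrable orthant_volume (\<lambda>x. (homotopy I v J x)\<^sup>2)"
    and "(\<Sum>J\<in>UNIV. LINT x|orthant_volume. (homotopy I v J x)\<^sup>2)
       \<le> (\<Sum>J\<in>UNIV. LINT x|orthant_volume. (v J x)\<^sup>2) / card I"
proof -
  have p: "0 < real (card I)" using I by (simp add: card_gt_0_iff)
  show "homotopy I v J \<in> borel_measurable borel"
    unfolding homotopy_def[abs_def] by measurable
  have a2: "integrable orthant_volume (\<lambda>x. (ctr_on I (\<lambda>K. v K x) J)\<^sup>2)" for J
    by (rule ctr_on_L2) (simp_all add: v2)
  show "integrable orthant_volume (\<lambda>x. (homotopy I v J x)\<^sup>2)"
    using flow_average_L2(1)[OF p _ a2] by (simp add: homotopy_def)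
  have "(\<Sum>J\<in>UNIV. LINT x|orthant_volume. (homotopy I v J x)\<^sup>2)
      \<le> (\<Sum>J\<in>UNIV. (LINT x|orthant_volume. (ctr_on I (\<lambda>K. v K x) J)\<^sup>2) / (card I)\<^sup>2)"
    using flow_average_L2(2)[OF p _ a2] by (intro sum_mono) (simp add: homotopy_def)
  also have "\<dots> = (LINT x|orthant_volume. (\<Sum>J\<in>UNIV. (ctr_on I (\<lambda>K. v K x) J)\<^sup>2)) / (card I)\<^sup>2"
    using a2 by (simp add: sum_divide_distrib)
  also have "\<dots> \<le> (LINT x|orthant_volume. card I * (\<Sum>J\<in>UNIV. (v J x)\<^sup>2)) / (card I)\<^sup>2"
    using a2 v2 sum_ctr_on_power2_le by (intro divide_right_mono integral_mono) auto
  also have "\<dots> = (\<Sum>J\<in>UNIV. LINT x|orthant_volume. (v J x)\<^sup>2) / card I"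
    using v2 p by (simp add: power2_eq_square)
  finally show "(\<Sum>J\<in>UNIV. LINT x|orthant_volume. (homotopy I v J x)\<^sup>2)
       \<le> (\<Sum>J\<in>UNIV. LINT x|orthant_volume. (v J x)\<^sup>2) / card I" .
qed

text \<open>Moved to the test form, the contraction becomes a wedge product and the flow runs
  backwards. Cartan's formula yields a term annihilated by closedness and the translates of
  \<open>G\<close>, that is of (p + X) \<psi>, whose average is \<psi>. Closedness is assumed for
  exactly those test forms that occur: translates of \<psi> multiplied by the dual covector.\<close>

lemma homotopy_weak:
  fixes v \<psi> :: "'n::{finite,linorder} set \<Rightarrow> real ^ ('n::{finite,linorder}) \<Rightarrow> real"
  assumes I: "I \<noteq> {}" and v [measurable]: "\<And>K. v K \<in> borel_measurable borel"
    and v2: "\<And>K. integrable orthant_volume (\<lambda>x. (v K x)\<^sup>2)"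
    and \<psi>: "\<And>J. \<psi> J \<in> test_functions"
    and closed: "\<And>y. (LINT x|orthant_volume. (\<Sum>J\<in>UNIV. v J x
          * twisted_delta I (\<lambda>K x. ext_on I (\<lambda>J. \<psi> J (dil y x)) K) J x)) = 0"
  shows "(LINT x|orthant_volume. (\<Sum>J\<in>UNIV. v J x * \<psi> J x))
       = (LINT x|orthant_volume. (\<Sum>J\<in>UNIV. homotopy I v J x * twisted_delta I \<psi> J x))"
proof -
  let ?p = "real (card I)" and ?\<theta> = "indic_vec I"
  define a where "a J x = ctr_on I (\<lambda>K. v K x) J" for J x
  define G where "G J x = ?p * \<psi> J x + (\<Sum>i\<in>UNIV. ?\<theta> $ i * log_deriv i (\<psi> J) x)" for J x
  have p: "0 < ?p" using I by (simp add: card_gt_0_iff)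
  have a_borel [measurable]: "a J \<in> borel_measurable borel" for J
    unfolding a_def[abs_def] by measurable
  have a2: "integrable orthant_volume (\<lambda>x. (a J x)\<^sup>2)" for J
    unfolding a_def by (rule ctr_on_L2) (simp_all add: v2)
  have \<delta>: "twisted_delta I \<psi> J \<in> test_functions" for J
    by (rule twisted_delta_test[OF \<psi>])
  have G: "G J \<in> test_functions" for J
    unfolding G_def[abs_def]
    by (intro test_functions_add test_functions_cmult test_functions_sum log_deriv_test \<psi>)
  have int: "integrable orthant_volume (\<lambda>x. f x * g x)"
    if [measurable]: "f \<in> borel_measurable borel" and "integrable orthant_volume (\<lambda>x. (f x)\<^sup>2)"
      and g: "g \<in> test_functions" for f g :: "real ^ ('n::{finite,linorder}) \<Rightarrow> real"
    using that test_functions_borel[OF g] test_functions_integrable_power2[OF g]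
    by (intro integrable_mult_L2) simp_all
  \<comment> \<open>For one translate: contraction passes to the test form by adjointness,
    \<open>twisted_delta\<close> commutes with the dilation, and Cartan's formula interchanges it
    with the wedge product.\<close>
  have pointwise: "(\<Sum>J\<in>UNIV. a J x * twisted_delta I \<psi> J (dil y x))
      = - (\<Sum>J\<in>UNIV. v J x * G J (dil y x))
        - (\<Sum>J\<in>UNIV. v J x * twisted_delta I (\<lambda>K x. ext_on I (\<lambda>J. \<psi> J (dil y x)) K) J x)" for x y
  proof -
    let ?\<psi> = "\<lambda>J x. \<psi> J (dil y x)"
    have \<psi>': "?\<psi> J \<in> test_functions" for J by (rule test_functions_dil[OF \<psi>])
    have "G J (dil y x) = ?p * ?\<psi> J x + (\<Sum>i\<in>I. log_deriv i (?\<psi> J) x)" for J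
      by (simp add: G_def log_deriv_dil[OF \<psi>] indic_vec_def if_distrib[of "\<lambda>t. t * _"] sum.If_cases cong: if_cong)
    then have c: "ext_on I (\<lambda>K. twisted_delta I ?\<psi> K x) J
        = - G J (dil y x) - twisted_delta I (\<lambda>K x. ext_on I (\<lambda>J. ?\<psi> J x) K) J x" for J
      using twisted_cartan[of ?\<psi> I x J, OF \<psi>'] by simp
    have "(\<Sum>J\<in>UNIV. a J x * twisted_delta I \<psi> J (dil y x))
        = (\<Sum>J\<in>UNIV. ext_on I (\<lambda>K. twisted_delta I ?\<psi> K x) J * v J x)"
      unfolding sum_ext_on_eq_sum_ctr_on by (simp add: a_def twisted_delta_dil[OF \<psi>] mult.commute)
    then show ?thesis
      unfolding c by (simp add: right_diff_distrib sum_subtractf sum_negf mult.commute[of _ "v _ x"])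
  qed
  have slice: "(\<Sum>J\<in>UNIV. LINT x|orthant_volume. a J x * twisted_delta I \<psi> J (dil y x))
      = - (\<Sum>J\<in>UNIV. LINT x|orthant_volume. v J x * G J (dil y x))" for y
  proof -
    have "(\<lambda>x. ext_on I (\<lambda>J. \<psi> J (dil y x)) K) \<in> test_functions" for K
      unfolding ext_on_def by (intro test_functions_sum ext_test test_functions_dil \<psi>)
    then have i: "integrable orthant_volume (\<lambda>x. v J x * twisted_delta I (\<lambda>K x. ext_on I (\<lambda>J. \<psi> J (dil y x)) K) J x)" for J
      by (intro int v v2 twisted_delta_test)
    have ia: "integrable orthant_volume (\<lambda>x. a J x * twisted_delta I \<psi> J (dil y x))" for J
      by (intro int a_borel a2 test_functions_dil \<delta>)
    have iG: "integrable orthant_volume (\<lambda>x. v J x * G J (dil y x))" for J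
      by (intro int v v2 test_functions_dil G)
    have "(\<Sum>J\<in>UNIV. LINT x|orthant_volume. a J x * twisted_delta I \<psi> J (dil y x))
        = (LINT x|orthant_volume. (\<Sum>J\<in>UNIV. a J x * twisted_delta I \<psi> J (dil y x)))"
      using ia by simp
    also have "\<dots> = - (LINT x|orthant_volume. (\<Sum>J\<in>UNIV. v J x * G J (dil y x)))"
      unfolding pointwise using closed[of y] i iG by simp
    also have "\<dots> = - (\<Sum>J\<in>UNIV. LINT x|orthant_volume. v J x * G J (dil y x))"
      using iG by simp
    finally show ?thesis .
  qed
  note adj = flow_average_adjoint[where \<theta> = ?\<theta>, OF p a_borel a2 \<delta>]
  note adj' = flow_average_adjoint[where \<theta> = ?\<theta>, OF p v v2 G]
  obtain j where "j \<in> I" using I by blast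
  then have j: "0 < ?\<theta> $ j" by (simp add: indic_vec_def)
  have h: "flow_average ?p ?\<theta> (a J) \<in> borel_measurable borel" for J by measurable
  have h2: "integrable orthant_volume (\<lambda>x. (flow_average ?p ?\<theta> (a J) x)\<^sup>2)" for J
    by (rule flow_average_L2(1)[OF p a_borel a2])
  have "(LINT x|orthant_volume. (\<Sum>J\<in>UNIV. homotopy I v J x * twisted_delta I \<psi> J x))
      = - (\<Sum>J\<in>UNIV. LINT x|orthant_volume. flow_average ?p ?\<theta> (a J) x * twisted_delta I \<psi> J x)"
    using int[OF h h2 \<delta>] by (simp add: homotopy_def a_def[abs_def] sum_negf)
  \<comment> \<open>With the time integral outermost, the slice identity applies for each s with y =
    - s \<theta>; the time integral is then folded back into an average of \<open>G\<close>.\<close>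
  also have "\<dots> = - (LINT s|lborel. decay ?p s * (\<Sum>J\<in>UNIV. LINT x|orthant_volume. a J x * twisted_delta I \<psi> J (dil (s *\<^sub>R - ?\<theta>) x)))"
    unfolding adj(2) sum_distrib_left using adj(1) by simp
  also have "\<dots> = (LINT s|lborel. decay ?p s * (\<Sum>J\<in>UNIV. LINT x|orthant_volume. v J x * G J (dil (s *\<^sub>R - ?\<theta>) x)))"
    unfolding slice by simp
  also have "\<dots> = (\<Sum>J\<in>UNIV. LINT x|orthant_volume. v J x * flow_average ?p (- ?\<theta>) (G J) x)"
    unfolding adj'(3) sum_distrib_left using adj'(1) by simp
  also have "\<dots> = (\<Sum>J\<in>UNIV. LINT x|orthant_volume. v J x * \<psi> J x)"
    unfolding G_def[abs_def] by (simp only: flow_average_generator[OF \<psi> j])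
  also have "\<dots> = (LINT x|orthant_volume. (\<Sum>J\<in>UNIV. v J x * \<psi> J x))"
    using int[OF v v2 \<psi>] by simp
  finally show ?thesis by simp
qed

section \<open>Forms in the orthonormal coframe\<close>

lemma matrix_inv_orthant_metric:
  assumes "x \<in> orthant"
  shows "matrix_inv (orthant_metric x) = (\<chi> i j. if i = j then (x $ j)\<^sup>2 else 0)"
proof -
  let ?A = "orthant_metric x" and ?B = "(\<chi> i j. if i = j then (x $ j)\<^sup>2 else 0) :: real ^ 'a ^ 'a"
  have nz: "x $ i \<noteq> 0" for i using assms by (simp add: orthant_def less_imp_neq[symmetric])
  have AB: "?A ** ?B = mat 1" "?B ** ?A = mat 1"
    by (auto simp: matrix_matrix_mult_def orthant_metric_def mat_def vec_eq_iff nz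
        if_distrib[of "\<lambda>t. t * _"] if_distrib[of "\<lambda>t. _ * t"] cong: if_cong)
  \<comment> \<open>\<open>matrix_inv\<close> is a choice among two-sided inverses. The existence of
    \<open>?B\<close> shows only that the choice is some inverse; associativity then identifies the
    two.\<close>
  have inv: "?A ** matrix_inv ?A = mat 1 \<and> matrix_inv ?A ** ?A = mat 1"
    unfolding matrix_inv_def
    by (rule someI[of "\<lambda>A'. ?A ** A' = mat 1 \<and> A' ** ?A = mat 1" ?B]) (rule conjI[OF AB])
  have "matrix_inv ?A = (?B ** ?A) ** matrix_inv ?A"
    unfolding AB(2) by simp
  also have "\<dots> = ?B ** (?A ** matrix_inv ?A)"
    by (rule matrix_mul_assoc[symmetric])
  also have "\<dots> = ?B"
    unfolding conjunct1[OF inv] by simp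
  finally show ?thesis .
qed

text \<open>A nonzero term of the determinant forces the r-th element of I to be the element of K at
  position \<sigma> r, for all r. Hence I \<subseteq> K, equal cardinalities give I = K, and
  distinctness of the enumeration gives \<sigma> = id.\<close>

lemma wedge_inner_diagonal:
  fixes I K :: "'n::{finite,linorder} set"
  shows "wedge_inner (\<chi> i j. if i = j then d j else 0) I K = (if I = K then \<Prod>i\<in>I. d i else 0)"
proof (cases "card I = card K")
  case False
  then show ?thesis by (auto simp: wedge_inner_def)
next
  case c: True
  let ?s = "sorted_list_of_set :: 'n set \<Rightarrow> 'n list"
  let ?P = "\<lambda>\<sigma>. \<Prod>r<card I. (if ?s I ! r = ?s K ! \<sigma> r then d (?s K ! \<sigma> r) else 0)"
  have nth: "?s J ! r \<in> J" if "r < card J" for J r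
    using nth_mem[of r "?s J"] that by simp
  have w: "wedge_inner (\<chi> i j. if i = j then d j else 0) I K
      = (\<Sum>\<sigma> | \<sigma> permutes {..<card I}. of_int (sign \<sigma>) * ?P \<sigma>)"
    using c by (simp add: wedge_inner_def)
  have P0: "?P \<sigma> = 0" if \<sigma>: "\<sigma> permutes {..<card I}" and "I \<noteq> K \<or> \<sigma> \<noteq> id" for \<sigma>
  proof (rule ccontr)
    assume "?P \<sigma> \<noteq> 0"
    then have eq: "?s I ! r = ?s K ! \<sigma> r" if "r < card I" for r
      using that by (auto simp: split: if_splits)
    have "I \<subseteq> K"
    proof
      fix i assume "i \<in> I"
      then obtain r where r: "r < card I" "i = ?s I ! r"
        by (metis finite in_set_conv_nth length_sorted_list_of_set set_sorted_list_of_set)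
      have "\<sigma> r < card K" using permutes_in_image[OF \<sigma>, of r] r(1) c by simp
      then show "i \<in> K" using eq[OF r(1)] nth r(2) by simp
    qed
    then have IK: "I = K" using c card_subset_eq[of K I] by simp
    have "\<sigma> r = r" for r
    proof (cases "r < card I")
      case True
      then have "\<sigma> r < card I" using permutes_in_image[OF \<sigma>, of r] by simp
      then show ?thesis
        using eq[OF True] True nth_eq_iff_index_eq[OF distinct_sorted_list_of_set[of I]] IK by simp
    next
      case False
      then show ?thesis using permutes_not_in[OF \<sigma>, of r] by simp
    qed
    then show False using that(2) IK by auto
  qed
  show ?thesis
  proof (cases "I = K")
    case False
    then show ?thesis using P0 w by (simp add: sum.neutral)
  next
    case True
    have "(\<Sum>\<sigma> | \<sigma> permutes {..<card I}. of_int (sign \<sigma>) * ?P \<sigma>)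
        = (\<Sum>\<sigma>\<in>{id}. of_int (sign \<sigma>) * ?P \<sigma>)"
      by (rule sum.mono_neutral_right) (auto simp: P0 finite_permutations)
    also have "\<dots> = (\<Prod>r<card I. d (?s I ! r))"
      using True by simp
    also have "\<dots> = (\<Prod>i\<in>I. d i)"
      by (rule prod.reindex_bij_betw)
         (use bij_betw_nth[of "?s I" "{..<card I}" I] in simp)
    finally show ?thesis using w True by simp
  qed
qed

lemma zero_form_apply: "(0 :: 'n form) I J x = 0"
  by (simp add: zero_fun_def)

lemma minus_form_apply: "(\<omega> - \<eta> :: 'n form) I J x = \<omega> I J x - \<eta> I J x"
  by (simp add: fun_diff_def)

text \<open>Coefficients in the orthonormal coframe \<open>dx\<^sup>i / x\<^sup>i\<close>.\<close>

definition frame :: "('n::{finite,linorder}) form \<Rightarrow> 'n form" where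
  "frame \<omega> I J x = (\<Prod>i\<in>I. x $ i) * ((\<Prod>j\<in>J. x $ j) * \<omega> I J x)"

definition unframe :: "('n::{finite,linorder}) form \<Rightarrow> 'n form" where
  "unframe \<psi> I J x = (\<Prod>i\<in>I. inverse (x $ i)) * ((\<Prod>j\<in>J. inverse (x $ j)) * \<psi> I J x)"

lemma prod_inverse_orthant:
  "x \<in> orthant \<Longrightarrow> (\<Prod>i\<in>I. inverse (x $ i)) * ((\<Prod>i\<in>I. x $ i) * t) = t"
  "x \<in> orthant \<Longrightarrow> (\<Prod>i\<in>I. x $ i) * ((\<Prod>i\<in>I. inverse (x $ i)) * t) = t"
proof -
  assume "x \<in> orthant"
  then have "x $ i \<noteq> 0" for i by (simp add: orthant_def less_imp_neq[symmetric])
  then have 1: "(\<Prod>i\<in>I. inverse (x $ i)) * (\<Prod>i\<in>I. x $ i) = 1"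
    by (simp add: prod.distrib[symmetric])
  then show "(\<Prod>i\<in>I. inverse (x $ i)) * ((\<Prod>i\<in>I. x $ i) * t) = t"
    by (simp only: mult.assoc[symmetric] mult_1_left)
  from 1 have "(\<Prod>i\<in>I. x $ i) * (\<Prod>i\<in>I. inverse (x $ i)) = 1"
    by (simp only: mult.commute)
  then show "(\<Prod>i\<in>I. x $ i) * ((\<Prod>i\<in>I. inverse (x $ i)) * t) = t"
    by (simp only: mult.assoc[symmetric] mult_1_left)
qed

text \<open>On the orthant the monomials cancel. Elsewhere a coordinate may be 0, with inverse 0 by
  convention, and the vanishing of the coefficient gives equality.\<close>

lemma frame_unframe:
  assumes "x \<notin> orthant \<Longrightarrow> \<psi> I J x = 0"
  shows "frame (unframe \<psi>) I J x = \<psi> I J x"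
proof (cases "x \<in> orthant")
  case True
  have "frame (unframe \<psi>) I J x = (\<Prod>i\<in>I. x $ i) * ((\<Prod>i\<in>I. inverse (x $ i))
      * ((\<Prod>j\<in>J. x $ j) * ((\<Prod>j\<in>J. inverse (x $ j)) * \<psi> I J x)))"
    by (simp add: frame_def unframe_def mult_ac)
  then show ?thesis by (simp add: prod_inverse_orthant True)
qed (use assms in \<open>simp add: frame_def unframe_def\<close>)

lemma frame_test: "\<omega> I J \<in> test_functions \<Longrightarrow> frame \<omega> I J \<in> test_functions"
  unfolding frame_def[abs_def]
  by (intro test_functions_smooth_mult smooth_on_prod smooth_on_coordinate open_orthant)

lemma unframe_test: "\<psi> I J \<in> test_functions \<Longrightarrow> unframe \<psi> I J \<in> test_functions"
  unfolding unframe_def[abs_def]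
  by (intro test_functions_smooth_mult smooth_on_prod smooth_on_inverse_coordinate open_orthant)

lemma frame_borel: "\<omega> I J \<in> borel_measurable borel \<Longrightarrow> frame \<omega> I J \<in> borel_measurable borel"
  unfolding frame_def[abs_def] by measurable

lemma unframe_borel: "\<psi> I J \<in> borel_measurable borel \<Longrightarrow> unframe \<psi> I J \<in> borel_measurable borel"
  unfolding unframe_def[abs_def] by measurable

text \<open>The induced product is diagonal in the multi-indices and its weights, squares of
  monomials, split evenly between the two frames. Outside the orthant the metric can be singular and
  \<open>matrix_inv\<close> unspecified; there both sides are 0 because \<omega> vanishes.\<close>

lemma form_inner_at_orthant_metric:
  fixes \<omega> \<eta> :: "('n::{finite,linorder}) form"
  assumes "\<And>I J. x \<notin> orthant \<Longrightarrow> \<omega> I J x = 0"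
  shows "form_inner_at orthant_metric \<omega> \<eta> x = (\<Sum>I\<in>UNIV. \<Sum>J\<in>UNIV. frame \<omega> I J x * frame \<eta> I J x)"
proof (cases "x \<in> orthant")
  case True
  let ?w = "\<lambda>I. \<Prod>i\<in>I. (x $ i)\<^sup>2"
  have w: "wedge_inner (matrix_inv (orthant_metric x)) I K = (if I = K then ?w I else 0)" for I K
    unfolding matrix_inv_orthant_metric[OF True] wedge_inner_diagonal ..
  have "(\<Sum>K\<in>UNIV. \<Sum>L\<in>UNIV. \<omega> I J x * \<eta> K L x * (if I = K then ?w I else 0) * (if J = L then ?w J else 0))
      = \<omega> I J x * \<eta> I J x * ?w I * ?w J" for I J
  proof -
    have "(\<Sum>L\<in>UNIV. \<omega> I J x * \<eta> K L x * (if I = K then ?w I else 0) * (if J = L then ?w J else 0))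
        = (if I = K then \<omega> I J x * \<eta> I J x * ?w I * ?w J else 0)" for K
      by (cases "I = K") (simp_all add: if_distrib[of "\<lambda>t. _ * t"] cong: if_cong)
    then show ?thesis by simp
  qed
  moreover have "\<omega> I J x * \<eta> I J x * ?w I * ?w J = frame \<omega> I J x * frame \<eta> I J x" for I J
  proof -
    have "?w A = (\<Prod>i\<in>A. x $ i) * (\<Prod>i\<in>A. x $ i)" for A
      by (simp add: power2_eq_square prod.distrib)
    then show ?thesis by (simp only: frame_def mult_ac)
  qed
  ultimately show ?thesis
    by (simp only: form_inner_at_def w)
qed (use assms in \<open>simp add: form_inner_at_def frame_def\<close>)

lemma form_inner_orthant_metric:
  assumes "\<And>I J x. x \<notin> orthant \<Longrightarrow> \<omega> I J x = 0"
  shows "form_inner orthant_metric \<omega> \<eta>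
    = (LINT x|orthant_volume. (\<Sum>I\<in>UNIV. \<Sum>J\<in>UNIV. frame \<omega> I J x * frame \<eta> I J x))"
  unfolding form_inner_def
  by (rule Bochner_Integration.integral_cong[OF refl]) (rule form_inner_at_orthant_metric[OF assms])

lemma forms_outside: "\<omega> \<in> forms p q \<Longrightarrow> x \<notin> orthant \<Longrightarrow> \<omega> I J x = 0"
  by (auto simp: forms_def)

lemma forms_degree: "\<omega> \<in> forms p q \<Longrightarrow> \<omega> I J x \<noteq> 0 \<Longrightarrow> card I = p \<and> int (card J) = q"
  by (auto simp: forms_def)

text \<open>There are finitely many coefficients, so the union of their supports is a common compact
  support.\<close>

lemma test_forms_iff: "\<omega> \<in> test_forms p q \<longleftrightarrow> \<omega> \<in> forms p q \<and> (\<forall>I J. \<omega> I J \<in> test_functions)"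
proof
  assume \<omega>: "\<omega> \<in> test_forms p q"
  then obtain K where "compact K" "K \<subseteq> orthant" "\<forall>I J x. x \<notin> K \<longrightarrow> \<omega> I J x = 0"
    unfolding test_forms_def by blast
  then have "\<omega> I J \<in> test_functions" for I J
    using \<omega> by (intro test_functionsI[of _ K]) (auto simp: test_forms_def smooth_forms_def smooth_on_def)
  then show "\<omega> \<in> forms p q \<and> (\<forall>I J. \<omega> I J \<in> test_functions)"
    using \<omega> by (auto simp: test_forms_def smooth_forms_def)
next
  assume \<omega>: "\<omega> \<in> forms p q \<and> (\<forall>I J. \<omega> I J \<in> test_functions)"
  then have "\<forall>I J. \<exists>K. compact K \<and> K \<subseteq> orthant \<and> (\<forall>x. x \<notin> K \<longrightarrow> \<omega> I J x = 0)"
    using test_functions_support by blast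
  then obtain K where K: "\<And>I J. compact (K I J)" "\<And>I J. K I J \<subseteq> orthant"
      "\<And>I J x. x \<notin> K I J \<Longrightarrow> \<omega> I J x = 0"
    by metis
  let ?K = "\<Union>I. \<Union>J. K I J"
  have "compact ?K" by (intro compact_UN finite K)
  moreover have "?K \<subseteq> orthant" using K(2) by blast
  moreover have "\<forall>I J x. x \<notin> ?K \<longrightarrow> \<omega> I J x = 0" using K(3) by blast
  moreover have "\<omega> \<in> smooth_forms p q"
    using \<omega> test_functions_smooth_on_orthant unfolding smooth_forms_def smooth_on_def by blast
  ultimately show "\<omega> \<in> test_forms p q"
    unfolding test_forms_def by blast
qed

text \<open>Differentiating the monomial of I gives the term that \<open>twisted_d\<close>
  subtracts; the monomial of K - {i} does not depend on x_i. The factor x_i of the logarithmic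
  derivative completes it to the monomial of K.\<close>

lemma frame_dbar:
  assumes \<alpha>: "\<And>I J. \<alpha> I J \<in> test_functions"
  shows "frame (dbar \<alpha>) I K x = twisted_d I (frame \<alpha> I) K x"
proof (cases "x \<in> orthant")
  case False
  have "log_deriv i (frame \<alpha> I J) x = 0" "frame \<alpha> I J x = 0" for i J
    by (intro test_functions_outside[OF _ False] log_deriv_test frame_test \<alpha>)+
  then have "twisted_d I (frame \<alpha> I) K x = 0"
    by (simp add: twisted_d_def if_distrib[of uminus] cong: if_cong)
  moreover have "frame (dbar \<alpha>) I K x = 0"
    using False by (simp add: frame_def dbar_def)
  ultimately show ?thesis by simp
next
  case True
  let ?m = "\<lambda>A. \<Prod>i\<in>A. x $ i"
  have ld: "log_deriv i (frame \<alpha> I L) x = (if i \<in> I then frame \<alpha> I L x else 0)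
      + ?m I * (?m L * log_deriv i (\<alpha> I L) x)" if "i \<notin> L" for i L
  proof -
    note d = test_functions_differentiable[OF \<alpha>]
    have d': "(\<lambda>x. (\<Prod>i\<in>L. x $ i) * \<alpha> I L x) differentiable at x"
      by (intro differentiable_mult differentiable_monomial d)
    have fr: "frame \<alpha> I L = (\<lambda>x. (\<Prod>i\<in>I. x $ i) * ((\<Prod>i\<in>L. x $ i) * \<alpha> I L x))"
      by (rule HOL.ext) (rule frame_def)
    have "log_deriv i (frame \<alpha> I L) x = ?m I * log_deriv i (\<lambda>x. (\<Prod>i\<in>L. x $ i) * \<alpha> I L x) x
        + log_deriv i (\<lambda>x. \<Prod>i\<in>I. x $ i) x * (?m L * \<alpha> I L x)"
      unfolding fr by (rule log_deriv_mult[OF differentiable_monomial d'])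
    also have "log_deriv i (\<lambda>x. (\<Prod>i\<in>L. x $ i) * \<alpha> I L x) x = ?m L * log_deriv i (\<alpha> I L) x"
      using that by (simp add: log_deriv_mult[OF differentiable_monomial d] log_deriv_monomial)
    finally show ?thesis unfolding fr by (simp add: log_deriv_monomial)
  qed
  have "twisted_d I (frame \<alpha> I) K x = (\<Sum>i\<in>K. wsign i K
      * (log_deriv i (frame \<alpha> I (K - {i})) x - (if i \<in> I then frame \<alpha> I (K - {i}) x else 0)))"
    unfolding twisted_d_def ext_def by (simp add: sum.If_cases)
  also have "\<dots> = (\<Sum>i\<in>K. wsign i K * (?m I * (?m (K - {i}) * log_deriv i (\<alpha> I (K - {i})) x)))"
    by (simp add: ld)
  also have "\<dots> = (\<Sum>i\<in>K. ?m I * (?m K * ((- 1) ^ card {k \<in> K - {i}. k < i} * pderiv_at i (\<alpha> I (K - {i})) x)))"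
  proof (rule sum.cong)
    fix i assume i: "i \<in> K"
    have "?m K = x $ i * ?m (K - {i})" using i by (simp add: prod.remove)
    moreover have "{k \<in> K - {i}. k < i} = {k \<in> K. k < i}" by auto
    ultimately show "wsign i K * (?m I * (?m (K - {i}) * log_deriv i (\<alpha> I (K - {i})) x))
        = ?m I * (?m K * ((- 1) ^ card {k \<in> K - {i}. k < i} * pderiv_at i (\<alpha> I (K - {i})) x))"
      by (simp add: wsign_def log_deriv_def mult_ac)
  qed simp
  also have "\<dots> = frame (dbar \<alpha>) I K x"
    using True by (simp add: frame_def dbar_def sum_distrib_left)
  finally show ?thesis ..
qed

section \<open>Computing the formal adjoint\<close>

lemma test_function_integral_eq_0:
  fixes f :: "real ^ 'n::finite \<Rightarrow> real"
  assumes f: "f \<in> test_functions" and nn: "\<And>x. 0 \<le> f x" and 0: "(LINT x|orthant_volume. f x) = 0"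
  shows "f x = 0"
proof (rule ccontr)
  assume x: "f x \<noteq> 0"
  have "AE x in orthant_volume. f x = 0"
    using integral_nonneg_eq_0_iff_AE[OF test_functions_integrable[OF f]] nn 0 by simp
  then have "AE x in lborel. 0 < ennreal (vol_density x) \<longrightarrow> f x = 0"
    unfolding orthant_volume_eq by (subst (asm) AE_density) auto
  moreover have "0 < ennreal (vol_density x)" if "x \<in> orthant" for x :: "real ^ 'n"
    using that by (auto simp: vol_density_def orthant_def intro!: prod_pos)
  ultimately have ae: "AE x in lborel. f x = 0"
    using test_functions_outside[OF f] by (auto elim!: eventually_mono)
  let ?U = "{x. f x \<noteq> 0}"
  have o: "open ?U"
    using test_functions_continuous[OF f] by (intro open_Collect_neq continuous_intros)
  have "?U \<in> null_sets lborel"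
    using ae AE_iff_null_sets[of ?U lborel] o by simp
  then have "negligible ?U"
    by (simp add: negligible_iff_null_sets null_sets_completionI)
  then show False using open_not_negligible[OF o] x by auto
qed

lemma test_functions_frame_mult:
  assumes "\<alpha> I J \<in> test_functions" "smooth_on orthant (\<zeta> I J)"
  shows "(\<lambda>x. frame \<alpha> I J x * frame \<zeta> I J x) \<in> test_functions"
proof -
  have "(\<lambda>x. frame \<zeta> I J x * frame \<alpha> I J x) \<in> test_functions"
    unfolding frame_def[of \<zeta>]
    by (intro test_functions_smooth_mult frame_test assms smooth_on_mult smooth_on_prod
        smooth_on_coordinate open_orthant)
  then show ?thesis by (simp add: mult.commute)
qed

text \<open>The fundamental lemma of the calculus of variations; it yields uniqueness in the
  definite description of \<open>dbar_adjoint\<close>. Smooth forms need not have compact support,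
  so their difference is cut off by a bump function before it serves as a test form.\<close>

lemma smooth_form_eqI:
  fixes \<zeta> \<xi> :: "('n::{finite,linorder}) form"
  assumes \<zeta>: "\<zeta> \<in> smooth_forms p q" and \<xi>: "\<xi> \<in> smooth_forms p q"
    and eq: "\<And>\<alpha>. \<alpha> \<in> test_forms p q \<Longrightarrow> form_inner orthant_metric \<alpha> \<zeta> = form_inner orthant_metric \<alpha> \<xi>"
  shows "\<zeta> = \<xi>"
proof (intro HOL.ext)
  fix I J and a :: "real ^ ('n::{finite,linorder})"
  have f: "\<zeta> \<in> forms p q" "\<xi> \<in> forms p q" using \<zeta> \<xi> by (auto simp: smooth_forms_def)
  show "\<zeta> I J a = \<xi> I J a"
  proof (cases "a \<in> orthant \<and> card I = p \<and> int (card J) = q")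
    case False
    then have "\<zeta> I J a = 0" "\<xi> I J a = 0"
      using f unfolding forms_def by blast+
    then show ?thesis by simp
  next
    case True
    then obtain b where b: "b \<in> test_functions" "\<And>x. 0 \<le> b x" "0 < b a"
      using exists_bump by blast
    have s: "smooth_on orthant (\<zeta> I J)" "smooth_on orthant (\<xi> I J)"
      using \<zeta> \<xi> by (auto simp: smooth_forms_def smooth_on_def)
    define d where "d x = \<zeta> I J x + (- 1) * \<xi> I J x" for x
    \<comment> \<open>Testing with a single component of the difference makes the two pairings
      differ by the integral of the bump function times a square.\<close>
    define \<alpha> where "\<alpha> I' J' x = (if I' = I \<and> J' = J then d x * b x else 0)" for I' J' x
    have ds: "smooth_on orthant d"
      unfolding d_def[abs_def] by (intro smooth_on_add smooth_on_mult smooth_on_const s open_orthant)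
    have db: "(\<lambda>x. d x * b x) \<in> test_functions"
      by (rule test_functions_smooth_mult[OF ds b(1)])
    have \<alpha>T: "\<alpha> I' J' \<in> test_functions" for I' J'
    proof -
      have "\<alpha> I' J' = (if I' = I \<and> J' = J then (\<lambda>x. d x * b x) else (\<lambda>x. 0))"
        by (auto simp: \<alpha>_def)
      then show ?thesis by (simp add: db test_functions_0)
    qed
    have \<alpha>: "\<alpha> \<in> test_forms p q"
      unfolding test_forms_iff
    proof
      show "\<alpha> \<in> forms p q"
        unfolding forms_def
      proof (intro CollectI allI impI)
        fix I' J' x assume n: "\<alpha> I' J' x \<noteq> 0"
        then have "I' = I \<and> J' = J" by (auto simp: \<alpha>_def split: if_splits)
        moreover have "x \<in> orthant" using n test_functions_outside[OF \<alpha>T] by blast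
        ultimately show "card I' = p \<and> int (card J') = q \<and> x \<in> orthant" using True by simp
      qed
    qed (use \<alpha>T in blast)
    have inner: "form_inner orthant_metric \<alpha> \<rho> = (LINT x|orthant_volume. frame \<alpha> I J x * frame \<rho> I J x)" for \<rho>
    proof -
      have "(\<Sum>I'\<in>UNIV. \<Sum>J'\<in>UNIV. frame \<alpha> I' J' x * frame \<rho> I' J' x) = frame \<alpha> I J x * frame \<rho> I J x" for x
      proof -
        have "(\<Sum>J'\<in>UNIV. frame \<alpha> I' J' x * frame \<rho> I' J' x)
            = (\<Sum>J'\<in>UNIV. if J' = J then (if I' = I then frame \<alpha> I J x * frame \<rho> I J x else 0) else 0)" for I'
          by (rule sum.cong) (auto simp: frame_def \<alpha>_def)
        then show ?thesis by simp
      qed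
      then show ?thesis
        using form_inner_orthant_metric[of \<alpha> \<rho>] test_functions_outside[OF \<alpha>T] by simp
    qed
    have sq: "frame \<alpha> I J x * frame \<zeta> I J x - frame \<alpha> I J x * frame \<xi> I J x
        = b x * ((\<Prod>i\<in>I. x $ i) * (\<Prod>j\<in>J. x $ j) * d x)\<^sup>2" for x
      by (simp add: frame_def \<alpha>_def d_def power2_eq_square algebra_simps)
    have i: "(\<lambda>x. frame \<alpha> I J x * frame \<zeta> I J x) \<in> test_functions"
      "(\<lambda>x. frame \<alpha> I J x * frame \<xi> I J x) \<in> test_functions"
      by (intro test_functions_frame_mult \<alpha>T s)+
    have "(\<lambda>x. frame \<alpha> I J x * frame \<zeta> I J x + (- 1) * (frame \<alpha> I J x * frame \<xi> I J x)) \<in> test_functions"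
      by (intro test_functions_add test_functions_cmult i)
    then have T: "(\<lambda>x. b x * ((\<Prod>i\<in>I. x $ i) * (\<Prod>j\<in>J. x $ j) * d x)\<^sup>2) \<in> test_functions"
      by (simp add: sq[symmetric])
    have "(LINT x|orthant_volume. b x * ((\<Prod>i\<in>I. x $ i) * (\<Prod>j\<in>J. x $ j) * d x)\<^sup>2) = 0"
      unfolding sq[symmetric] using test_functions_integrable[OF i(1)] test_functions_integrable[OF i(2)]
        eq[OF \<alpha>] by (simp add: inner)
    then have "b a * ((\<Prod>i\<in>I. a $ i) * (\<Prod>j\<in>J. a $ j) * d a)\<^sup>2 = 0"
      by (intro test_function_integral_eq_0[OF T]) (simp add: b(2))
    moreover have "a $ i \<noteq> 0" for i
      using True by (simp add: orthant_def less_imp_neq[symmetric])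
    ultimately show ?thesis
      using b(3) by (simp add: d_def)
  qed
qed

definition codiff :: "('n::{finite,linorder}) form \<Rightarrow> 'n form" where
  "codiff \<eta> = unframe (\<lambda>I. twisted_delta I (frame \<eta> I))"

text \<open>A nonzero value comes from contraction at some i outside J, so the coefficient at
  \<open>insert i J\<close> is not identically 0. It may vanish at x while its derivative does not,
  hence the existential over points; the witness later fixes the cardinality of I.\<close>

lemma twisted_delta_degree:
  assumes "\<And>J x. \<psi> J x \<noteq> 0 \<Longrightarrow> int (card J) = q + 1" "twisted_delta I \<psi> J x \<noteq> 0"
  shows "int (card J) = q \<and> (\<exists>K x. \<psi> K x \<noteq> 0)"
proof -
  obtain i where i: "ctr i (\<lambda>K. log_deriv i (\<psi> K) x + (if i \<in> I then \<psi> K x else 0)) J \<noteq> 0"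
    using assms(2) unfolding twisted_delta_def by (metis (mono_tags, lifting) neg_equal_0_iff_equal sum.neutral)
  then have J: "i \<notin> J" and n: "log_deriv i (\<psi> (insert i J)) x + (if i \<in> I then \<psi> (insert i J) x else 0) \<noteq> 0"
    by (auto simp: ctr_def split: if_splits)
  have "\<exists>y. \<psi> (insert i J) y \<noteq> 0"
  proof (rule ccontr)
    assume "\<nexists>y. \<psi> (insert i J) y \<noteq> 0"
    then have "\<psi> (insert i J) = (\<lambda>x. 0)" by auto
    then show False using n by (simp add: log_deriv_const split: if_splits)
  qed
  then show ?thesis using assms(1) J by force
qed

lemma codiff_test:
  assumes \<eta>: "\<eta> \<in> test_forms p (q + 1)"
  shows "codiff \<eta> \<in> test_forms p q"
    and "frame (codiff \<eta>) I J = twisted_delta I (frame \<eta> I) J"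
proof -
  have T: "frame \<eta> I J \<in> test_functions" for I J
    using \<eta> by (simp add: test_forms_iff frame_test)
  have \<delta>: "twisted_delta I (frame \<eta> I) J \<in> test_functions" for I J
    by (rule twisted_delta_test[OF T])
  show "frame (codiff \<eta>) I J = twisted_delta I (frame \<eta> I) J"
    unfolding codiff_def by (rule HOL.ext, rule frame_unframe) (rule test_functions_outside[OF \<delta>])
  have deg: "card I = p \<and> int (card J) = q + 1" if "frame \<eta> I J x \<noteq> 0" for I J x
    using that \<eta> forms_degree[of \<eta> p "q + 1" I J x] by (auto simp: frame_def test_forms_iff)
  show "codiff \<eta> \<in> test_forms p q"
    unfolding test_forms_iff
  proof (intro conjI allI)
    show cT: "codiff \<eta> I J \<in> test_functions" for I J
      unfolding codiff_def by (rule unframe_test[OF \<delta>])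
    have "card I = p \<and> int (card J) = q \<and> x \<in> orthant" if "codiff \<eta> I J x \<noteq> 0" for I J x
    proof -
      have "twisted_delta I (frame \<eta> I) J x \<noteq> 0"
        using that by (auto simp: codiff_def unframe_def)
      then show ?thesis
        using twisted_delta_degree[of "frame \<eta> I" q I J x] deg test_functions_outside[OF cT] that by blast
    qed
    then show "codiff \<eta> \<in> forms p q" by (simp add: forms_def)
  qed
qed

lemma twisted_d_test:
  assumes "\<And>J. \<alpha> J \<in> test_functions"
  shows "twisted_d I \<alpha> K \<in> test_functions"
proof -
  have c: "(\<lambda>x. log_deriv i (\<alpha> J) x + c * \<alpha> J x) \<in> test_functions" for c i J
    by (intro test_functions_add log_deriv_test test_functions_cmult assms)
  have "(\<lambda>x. log_deriv i (\<alpha> J) x - (if i \<in> I then \<alpha> J x else 0)) \<in> test_functions" for i J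
    using c[of i J "- 1"] c[of i J 0] by (cases "i \<in> I") simp_all
  then show ?thesis
    unfolding twisted_d_def[abs_def] by (intro test_functions_sum ext_test)
qed

text \<open>Existence is integration by parts for each I separately, as \<open>dbar\<close> does not
  mix different I; uniqueness is \<open>smooth_form_eqI\<close>.\<close>

lemma dbar_adjoint_eq_codiff:
  assumes \<eta>: "\<eta> \<in> test_forms p (q + 1)"
  shows "dbar_adjoint orthant_metric p q \<eta> = codiff \<eta>"
  unfolding dbar_adjoint_def
proof (rule the_equality)
  have adj: "form_inner orthant_metric (dbar \<alpha>) \<eta> = form_inner orthant_metric \<alpha> (codiff \<eta>)"
    if \<alpha>: "\<alpha> \<in> test_forms p q" for \<alpha>
  proof -
    have \<alpha>T: "\<alpha> I J \<in> test_functions" and \<eta>T: "\<eta> I J \<in> test_functions" for I J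
      using \<alpha> \<eta> by (simp_all add: test_forms_iff)
    have T: "frame \<alpha> I J \<in> test_functions" "frame \<eta> I J \<in> test_functions" for I J
      using \<alpha>T \<eta>T by (simp_all add: frame_test)
    have i: "integrable orthant_volume (\<lambda>x. \<Sum>K\<in>UNIV. twisted_d I (frame \<alpha> I) K x * frame \<eta> I K x)" for I
      by (intro test_functions_integrable test_functions_sum test_functions_mult T twisted_d_test)
    have j: "integrable orthant_volume (\<lambda>x. \<Sum>J\<in>UNIV. frame \<alpha> I J x * twisted_delta I (frame \<eta> I) J x)" for I
      by (intro test_functions_integrable test_functions_sum test_functions_mult T twisted_delta_test)
    have d0: "dbar \<alpha> I J x = 0" if "x \<notin> orthant" for I J x
      using that by (simp add: dbar_def)
    have "form_inner orthant_metric (dbar \<alpha>) \<eta>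
        = (LINT x|orthant_volume. (\<Sum>I\<in>UNIV. \<Sum>K\<in>UNIV. twisted_d I (frame \<alpha> I) K x * frame \<eta> I K x))"
      by (subst form_inner_orthant_metric) (simp_all add: d0 frame_dbar[of \<alpha>, OF \<alpha>T])
    also have "\<dots> = (LINT x|orthant_volume. (\<Sum>I\<in>UNIV. \<Sum>J\<in>UNIV. frame \<alpha> I J x * twisted_delta I (frame \<eta> I) J x))"
      using i j by (simp add: integration_by_parts[of "frame \<alpha> _" "frame \<eta> _", OF T])
    also have "\<dots> = form_inner orthant_metric \<alpha> (codiff \<eta>)"
      by (subst form_inner_orthant_metric) (simp_all add: test_functions_outside[OF \<alpha>T] codiff_test(2)[OF \<eta>])
    finally show ?thesis .
  qed
  moreover have "codiff \<eta> \<in> smooth_forms p q"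
    using codiff_test(1)[OF \<eta>] by (simp add: test_forms_def)
  ultimately show "codiff \<eta> \<in> smooth_forms p q \<and>
      (\<forall>\<alpha>\<in>test_forms p q. form_inner orthant_metric (dbar \<alpha>) \<eta> = form_inner orthant_metric \<alpha> (codiff \<eta>))"
    by blast
  then show "\<zeta> = codiff \<eta>" if "\<zeta> \<in> smooth_forms p q \<and>
      (\<forall>\<alpha>\<in>test_forms p q. form_inner orthant_metric (dbar \<alpha>) \<eta> = form_inner orthant_metric \<alpha> \<zeta>)" for \<zeta>
    using that by (intro smooth_form_eqI[of \<zeta> p q "codiff \<eta>"]) auto
qed

section \<open>Vanishing of the cohomology\<close>

lemma L2_forms_iff:
  fixes \<omega> :: "('n::{finite,linorder}) form"
  shows "\<omega> \<in> L2_forms orthant_metric p q \<longleftrightarrow> \<omega> \<in> forms p q \<and> (\<forall>I J. \<omega> I J \<in> borel_measurable borel)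
      \<and> (\<forall>I J. integrable orthant_volume (\<lambda>x. (frame \<omega> I J x)\<^sup>2))"
proof (cases "\<omega> \<in> forms p q \<and> (\<forall>I J. \<omega> I J \<in> borel_measurable borel)")
  case True
  have [measurable]: "frame \<omega> I J \<in> borel_measurable borel" for I J
    using True by (simp add: frame_borel)
  have "form_inner_at orthant_metric \<omega> \<omega> x = (\<Sum>I\<in>UNIV. \<Sum>J\<in>UNIV. (frame \<omega> I J x)\<^sup>2)" for x
  proof -
    have "\<omega> I J x = 0" if "x \<notin> orthant" for I J
      using forms_outside that True by blast
    from form_inner_at_orthant_metric[of x \<omega> \<omega>, OF this] show ?thesis
      by (simp add: power2_eq_square)
  qed
  then have eq: "form_inner_at orthant_metric \<omega> \<omega> = (\<lambda>x. \<Sum>I\<in>UNIV. \<Sum>J\<in>UNIV. (frame \<omega> I J x)\<^sup>2)"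
    by (rule HOL.ext)
  have "integrable orthant_volume (\<lambda>x. (frame \<omega> I J x)\<^sup>2)"
    if i: "integrable orthant_volume (form_inner_at orthant_metric \<omega> \<omega>)" for I J
  proof (rule Bochner_Integration.integrable_bound[OF i])
    have "(frame \<omega> I J x)\<^sup>2 \<le> (\<Sum>I\<in>UNIV. \<Sum>J\<in>UNIV. (frame \<omega> I J x)\<^sup>2)" for x
    proof -
      have "(frame \<omega> I J x)\<^sup>2 \<le> (\<Sum>J\<in>UNIV. (frame \<omega> I J x)\<^sup>2)"
        by (rule member_le_sum) auto
      also have "\<dots> \<le> (\<Sum>I\<in>UNIV. \<Sum>J\<in>UNIV. (frame \<omega> I J x)\<^sup>2)"
        by (rule member_le_sum[of I UNIV "\<lambda>I. \<Sum>J\<in>UNIV. (frame \<omega> I J x)\<^sup>2"]) (auto intro: sum_nonneg)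
      finally show ?thesis .
    qed
    then show "AE x in orthant_volume. norm ((frame \<omega> I J x)\<^sup>2) \<le> norm (form_inner_at orthant_metric \<omega> \<omega> x)"
      unfolding eq by (intro AE_I2) (simp add: sum_nonneg)
  qed simp
  then show ?thesis
    using True by (auto simp: L2_forms_def eq)
qed (auto simp: L2_forms_def)

lemma L2_formsD:
  assumes "\<omega> \<in> L2_forms orthant_metric p q"
  shows "\<omega> \<in> forms p q" "\<omega> I J \<in> borel_measurable borel" "frame \<omega> I J \<in> borel_measurable borel"
    "integrable orthant_volume (\<lambda>x. (frame \<omega> I J x)\<^sup>2)"
  using assms by (simp_all add: L2_forms_iff frame_borel)

lemma integrable_frame_test:
  assumes "\<omega> \<in> L2_forms orthant_metric p q" "f \<in> test_functions"
  shows "integrable orthant_volume (\<lambda>x. frame \<omega> I J x * f x)"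
  using L2_formsD(3,4)[OF assms(1)] test_functions_borel[OF assms(2)]
    test_functions_integrable_power2[OF assms(2)]
  by (intro integrable_mult_L2) simp_all

lemma form_inner_test:
  assumes \<omega>: "\<omega> \<in> L2_forms orthant_metric p q" and T: "\<And>I J. frame \<eta> I J \<in> test_functions"
  shows "form_inner orthant_metric \<omega> \<eta>
    = (\<Sum>I\<in>UNIV. LINT x|orthant_volume. (\<Sum>J\<in>UNIV. frame \<omega> I J x * frame \<eta> I J x))"
  using form_inner_orthant_metric[of \<omega> \<eta>] forms_outside[OF L2_formsD(1)[OF \<omega>]]
  by (simp add: integrable_frame_test[OF \<omega> T])

lemma form_inner_self:
  assumes \<omega>: "\<omega> \<in> L2_forms orthant_metric p q"
  shows "form_inner orthant_metric \<omega> \<omega>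
    = (\<Sum>I\<in>UNIV. \<Sum>J\<in>UNIV. LINT x|orthant_volume. (frame \<omega> I J x)\<^sup>2)"
  using form_inner_orthant_metric[of \<omega> \<omega>] forms_outside[OF L2_formsD(1)[OF \<omega>]] L2_formsD(4)[OF \<omega>]
  by (simp add: power2_eq_square)

lemma form_inner_zero: "form_inner g 0 \<eta> = 0"
  by (simp add: form_inner_def form_inner_at_def zero_form_apply)

lemma frame_degree:
  "\<omega> \<in> forms p q \<Longrightarrow> frame \<omega> I J x \<noteq> 0 \<Longrightarrow> card I = p \<and> int (card J) = q \<and> x \<in> orthant"
  by (auto simp: frame_def forms_def)

lemma form_inner_codiff:
  assumes "\<omega> \<in> L2_forms orthant_metric p q'" "\<eta> \<in> test_forms p (q + 1)"
  shows "form_inner orthant_metric \<omega> (codiff \<eta>)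
    = (\<Sum>I\<in>UNIV. LINT x|orthant_volume. (\<Sum>J\<in>UNIV. frame \<omega> I J x * twisted_delta I (frame \<eta> I) J x))"
proof -
  have "frame \<eta> I J \<in> test_functions" for I J
    using assms(2) by (simp add: test_forms_iff frame_test)
  then show ?thesis
    using form_inner_test[OF assms(1), of "codiff \<eta>"] by (simp add: codiff_test(2)[OF assms(2)] twisted_delta_test)
qed

lemma ctr_zero [simp]: "ctr i (\<lambda>K. 0) J = 0"
  by (simp add: ctr_def)

lemma twisted_delta_zero: "twisted_delta I (\<lambda>J x. 0) J x = 0"
  by (simp add: twisted_delta_def log_deriv_const)

lemma ctr_on_zero [simp]: "ctr_on I (\<lambda>K. 0) J = 0"
  by (simp add: ctr_on_def)

text \<open>The test form is \<psi> in the component I and 0 in all others, carried back to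
  coordinate coefficients. Thus weak closedness, stated for whole forms, becomes available for each
  I.\<close>

lemma closed_imp_twisted_closed:
  fixes v :: "('n::{finite,linorder}) form"
  assumes v: "v \<in> L2_forms orthant_metric p q" and closed: "weak_dbar orthant_metric p q v 0"
    and T: "\<And>K. \<psi> K \<in> test_functions" and I: "card I = p"
    and deg: "\<And>K x. \<psi> K x \<noteq> 0 \<Longrightarrow> int (card K) = q + 1"
  shows "(LINT x|orthant_volume. (\<Sum>J\<in>UNIV. frame v I J x * twisted_delta I \<psi> J x)) = 0"
proof -
  define \<phi> where "\<phi> = (\<lambda>I' K x. if I' = I then \<psi> K x else 0)"
  have \<phi>T: "\<phi> I' K \<in> test_functions" for I' K
    by (cases "I' = I") (simp_all add: \<phi>_def T test_functions_0)
  have F: "frame (unframe \<phi>) I' = \<phi> I'" for I'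
    by (intro HOL.ext frame_unframe test_functions_outside[OF \<phi>T])
  have \<eta>: "unframe \<phi> \<in> test_forms p (q + 1)"
    unfolding test_forms_iff
  proof (intro conjI allI unframe_test \<phi>T)
    have "card I' = p \<and> int (card K) = q + 1 \<and> x \<in> orthant" if n: "unframe \<phi> I' K x \<noteq> 0" for I' K x
    proof -
      have n': "\<phi> I' K x \<noteq> 0" using n by (auto simp: unframe_def)
      then have "x \<in> orthant" using test_functions_outside[OF \<phi>T] by blast
      then show ?thesis using n' I deg[of K x] by (auto simp: \<phi>_def split: if_splits)
    qed
    then show "unframe \<phi> \<in> forms p (q + 1)" by (simp add: forms_def)
  qed
  have "form_inner orthant_metric 0 (unframe \<phi>) = form_inner orthant_metric v (codiff (unframe \<phi>))"
    using closed \<eta> unfolding weak_dbar_def by (simp add: dbar_adjoint_eq_codiff)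
  then have "0 = (\<Sum>I'\<in>UNIV. LINT x|orthant_volume. (\<Sum>J\<in>UNIV. frame v I' J x * twisted_delta I' (\<phi> I') J x))"
    unfolding form_inner_codiff[OF v \<eta>] form_inner_zero F .
  also have "\<dots> = (\<Sum>I'\<in>{I}. LINT x|orthant_volume. (\<Sum>J\<in>UNIV. frame v I' J x * twisted_delta I' (\<phi> I') J x))"
    by (rule sum.mono_neutral_right) (auto simp: \<phi>_def twisted_delta_zero)
  finally show ?thesis by (simp add: \<phi>_def)
qed

section \<open>The primitive of a closed form\<close>

definition primitive :: "('n::{finite,linorder}) form \<Rightarrow> 'n form" where
  "primitive v = unframe (\<lambda>I. homotopy I (frame v I))"

text \<open>A nonzero average has a nonzero integrand at some time, and dilations preserve the
  orthant. For q = 0 no J has cardinality q - 1, so the homotopy is 0, in keeping with the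
  convention on (p,-1)-forms.\<close>

lemma homotopy_degree:
  assumes v: "v \<in> forms p q" and n: "homotopy I (frame v I) J x \<noteq> 0"
  shows "card I = p \<and> int (card J) = q - 1 \<and> x \<in> orthant"
proof -
  have "\<exists>s. ctr_on I (\<lambda>K. frame v I K (dil (s *\<^sub>R indic_vec I) x)) J \<noteq> 0"
  proof (rule ccontr)
    assume "\<not> ?thesis"
    then show False using n by (simp add: homotopy_def flow_average_def)
  qed
  then obtain s i where "ctr i (\<lambda>K. frame v I K (dil (s *\<^sub>R indic_vec I) x)) J \<noteq> 0"
    unfolding ctr_on_def by (meson sum.neutral)
  then have "i \<notin> J" "frame v I (insert i J) (dil (s *\<^sub>R indic_vec I) x) \<noteq> 0"
    by (auto simp: ctr_def split: if_splits)
  then show ?thesis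
    using frame_degree[OF v] by fastforce
qed

lemma primitive_properties:
  fixes v :: "('n::{finite,linorder}) form"
  assumes p: "1 \<le> p" and v: "v \<in> L2_forms orthant_metric p q"
  shows "frame (primitive v) I J = homotopy I (frame v I) J"
    and "primitive v \<in> L2_forms orthant_metric p (q - 1)"
    and "form_inner orthant_metric (primitive v) (primitive v) \<le> form_inner orthant_metric v v / p"
proof -
  note vD = L2_formsD[OF v]
  have F: "frame (primitive v) I J = homotopy I (frame v I) J" for I J
    unfolding primitive_def using homotopy_degree[OF vD(1)] by (intro HOL.ext frame_unframe) blast
  then show "frame (primitive v) I J = homotopy I (frame v I) J" .
  \<comment> \<open>\<open>homotopy_L2\<close> asks for a nonempty I; p \<ge> 1 ensures this when
    card I = p, and all other components vanish.\<close>
  have zero: "homotopy I (frame v I) J x = 0" "frame v I J x = 0" if "card I \<noteq> p" for I J x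
    using that homotopy_degree[OF vD(1)] frame_degree[OF vD(1)] by blast+
  have nonempty: "I \<noteq> {}" if "card I = p" for I :: "'n set"
    using that p by auto
  have H: "homotopy I (frame v I) J \<in> borel_measurable borel
      \<and> integrable orthant_volume (\<lambda>x. (homotopy I (frame v I) J x)\<^sup>2)" for I J
  proof (cases "card I = p")
    case True
    then show ?thesis using homotopy_L2(1,2)[of I "frame v I", OF nonempty vD(3,4)] by blast
  next
    case False
    then have "homotopy I (frame v I) J = (\<lambda>x. 0)" using zero by blast
    then show ?thesis by simp
  qed
  show u: "primitive v \<in> L2_forms orthant_metric p (q - 1)"
    unfolding L2_forms_iff
  proof (intro conjI allI)
    have "card I = p \<and> int (card J) = q - 1 \<and> x \<in> orthant" if "primitive v I J x \<noteq> 0" for I J x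
    proof -
      have "homotopy I (frame v I) J x \<noteq> 0" using that by (auto simp: primitive_def unframe_def)
      then show ?thesis by (rule homotopy_degree[OF vD(1)])
    qed
    then show "primitive v \<in> forms p (q - 1)" by (simp add: forms_def)
    show "primitive v I J \<in> borel_measurable borel" for I J
      unfolding primitive_def using H by (intro unframe_borel) blast
    show "integrable orthant_volume (\<lambda>x. (frame (primitive v) I J x)\<^sup>2)" for I J
      using H by (simp add: F)
  qed
  have "(\<Sum>J\<in>UNIV. LINT x|orthant_volume. (homotopy I (frame v I) J x)\<^sup>2)
      \<le> (\<Sum>J\<in>UNIV. LINT x|orthant_volume. (frame v I J x)\<^sup>2) / p" for I
  proof (cases "card I = p")
    case True
    then show ?thesis using homotopy_L2(3)[of I "frame v I", OF nonempty vD(3,4)] by simp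
  qed (simp add: zero)
  then have "(\<Sum>I\<in>UNIV. \<Sum>J\<in>UNIV. LINT x|orthant_volume. (homotopy I (frame v I) J x)\<^sup>2)
      \<le> (\<Sum>I\<in>UNIV. (\<Sum>J\<in>UNIV. LINT x|orthant_volume. (frame v I J x)\<^sup>2) / p)"
    by (rule sum_mono)
  then show "form_inner orthant_metric (primitive v) (primitive v) \<le> form_inner orthant_metric v v / p"
    unfolding form_inner_self[OF u] form_inner_self[OF v] F by (simp add: sum_divide_distrib)
qed

text \<open>The sum of \<open>homotopy_weak\<close> over I. For q = 0 the primitive is 0 and the
  same computation shows that v is orthogonal to all test forms.\<close>

lemma weak_dbar_primitive:
  fixes v :: "('n::{finite,linorder}) form"
  assumes p: "1 \<le> p" and v: "v \<in> L2_forms orthant_metric p q"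
    and closed: "weak_dbar orthant_metric p q v 0"
  shows "weak_dbar orthant_metric p (q - 1) (primitive v) v"
  unfolding weak_dbar_def
proof (intro conjI ballI)
  note u = primitive_properties[OF p v]
  show "primitive v \<in> L2_forms orthant_metric p (q - 1)" by (rule u(2))
  show "v \<in> L2_forms orthant_metric p (q - 1 + 1)" using v by simp
  fix \<eta> :: "'n form" assume \<eta>: "\<eta> \<in> test_forms p (q - 1 + 1)"
  have T: "frame \<eta> I J \<in> test_functions" for I J
    using \<eta> by (simp add: test_forms_iff frame_test)
  have deg: "card I = p \<and> int (card J) = q" if "frame \<eta> I J x \<noteq> 0" for I J x
    using that \<eta> frame_degree[of \<eta> p q I J x] by (simp add: test_forms_iff)
  have eq: "(LINT x|orthant_volume. (\<Sum>J\<in>UNIV. frame v I J x * frame \<eta> I J x))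
      = (LINT x|orthant_volume. (\<Sum>J\<in>UNIV. frame (primitive v) I J x * twisted_delta I (frame \<eta> I) J x))" for I
  proof (cases "card I = p")
    case False
    then have "frame \<eta> I = (\<lambda>J x. 0)" using deg by blast
    then show ?thesis by (simp add: twisted_delta_zero)
  next
    case True
    then have I: "I \<noteq> {}" using p by auto
    show ?thesis
      unfolding u(1)
    proof (rule homotopy_weak[of I "frame v I" "frame \<eta> I", OF I L2_formsD(3)[OF v] L2_formsD(4)[OF v] T])
      fix y
      \<comment> \<open>The wedge product raises the second degree from q to q + 1, the degree of
        the test forms against which v is closed.\<close>
      let ?\<psi> = "\<lambda>K x. ext_on I (\<lambda>J. frame \<eta> I J (dil y x)) K"
      show "(LINT x|orthant_volume. (\<Sum>J\<in>UNIV. frame v I J x * twisted_delta I ?\<psi> J x)) = 0"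
      proof (rule closed_imp_twisted_closed[OF v closed _ True])
        show "?\<psi> K \<in> test_functions" for K
          unfolding ext_on_def by (intro test_functions_sum ext_test test_functions_dil T)
        show "int (card K) = q + 1" if n: "?\<psi> K x \<noteq> 0" for K x
        proof -
          obtain i where "ext i (\<lambda>J. frame \<eta> I J (dil y x)) K \<noteq> 0"
            using n unfolding ext_on_def by (rule sum.not_neutral_contains_not_neutral)
          then have i: "i \<in> K" "frame \<eta> I (K - {i}) (dil y x) \<noteq> 0"
            by (simp_all add: ext_def split: if_splits)
          have "int (card (K - {i})) = q"
            using deg[OF i(2)] by (rule conjunct2)
          moreover have "Suc (card (K - {i})) = card K"
            using i(1) by (intro card_Suc_Diff1) simp_all
          ultimately show ?thesis by linarith
        qed
      qed
    qed
  qed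
  show "form_inner orthant_metric v \<eta> = form_inner orthant_metric (primitive v) (dbar_adjoint orthant_metric p (q - 1) \<eta>)"
    unfolding dbar_adjoint_eq_codiff[OF \<eta>] form_inner_codiff[OF u(2) \<eta>] form_inner_test[OF v T] eq ..
qed

section \<open>Closed forms and the quotient\<close>

lemma zero_L2_forms: "(0 :: ('a::{finite,linorder}) form) \<in> L2_forms g p q"
proof -
  have "form_inner_at g 0 0 = (\<lambda>x. 0)"
    by (simp add: fun_eq_iff form_inner_at_def zero_form_apply)
  then have "integrable (riemannian_volume g) (form_inner_at g 0 0)"
    by (simp only: Bochner_Integration.integrable_zero)
  moreover have "(0 :: 'a form) I J \<in> borel_measurable borel" for I J
    unfolding zero_fun_def by (rule measurable_const) simp
  moreover have "(0 :: 'a form) \<in> forms p q"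
    by (simp add: forms_def zero_form_apply)
  ultimately show ?thesis unfolding L2_forms_def by blast
qed

lemma L2_forms_diff:
  assumes \<omega>: "\<omega> \<in> L2_forms orthant_metric p q" and \<eta>: "\<eta> \<in> L2_forms orthant_metric p q"
  shows "\<omega> - \<eta> \<in> L2_forms orthant_metric p q"
    and "frame (\<omega> - \<eta>) I J x = frame \<omega> I J x - frame \<eta> I J x"
proof -
  have F: "frame (\<omega> - \<eta>) I J x = frame \<omega> I J x - frame \<eta> I J x" for I J x
    by (simp add: frame_def minus_form_apply algebra_simps)
  then show "frame (\<omega> - \<eta>) I J x = frame \<omega> I J x - frame \<eta> I J x" .
  note D = L2_formsD[OF \<omega>] L2_formsD[OF \<eta>]
  show "\<omega> - \<eta> \<in> L2_forms orthant_metric p q"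
    unfolding L2_forms_iff
  proof (intro conjI allI)
    show "\<omega> - \<eta> \<in> forms p q"
      unfolding forms_def
    proof (intro CollectI allI impI)
      fix I J x assume "(\<omega> - \<eta>) I J x \<noteq> 0"
      then have "\<omega> I J x \<noteq> 0 \<or> \<eta> I J x \<noteq> 0" by (auto simp: minus_form_apply)
      then show "card I = p \<and> int (card J) = q \<and> x \<in> orthant"
        using D(1,5) unfolding forms_def by blast
    qed
    have "(\<omega> - \<eta>) I J = (\<lambda>x. \<omega> I J x - \<eta> I J x)" for I J
      by (simp add: fun_eq_iff minus_form_apply)
    then show "(\<omega> - \<eta>) I J \<in> borel_measurable borel" for I J
      using D(2,6) by simp
    show "integrable orthant_volume (\<lambda>x. (frame (\<omega> - \<eta>) I J x)\<^sup>2)" for I J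
      unfolding F power2_diff using D(4,8) integrable_mult_L2[OF _ _ D(4,8)] D(3,7)
      by (simp add: mult.assoc)
  qed
qed

text \<open>\<open>cohomologous\<close> compares closed forms through their difference, which must
  be closed itself to have a primitive. The pairing with \<open>codiff \<phi>\<close> splits because
  all products are integrable.\<close>

lemma weak_dbar_0_diff:
  assumes "weak_dbar orthant_metric p q \<omega> 0" "weak_dbar orthant_metric p q \<eta> 0"
  shows "weak_dbar orthant_metric p q (\<omega> - \<eta>) 0"
  unfolding weak_dbar_def
proof (intro conjI ballI zero_L2_forms)
  have \<omega>: "\<omega> \<in> L2_forms orthant_metric p q" and \<eta>: "\<eta> \<in> L2_forms orthant_metric p q"
    using assms by (auto simp: weak_dbar_def)
  note d = L2_forms_diff[OF \<omega> \<eta>]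
  show "\<omega> - \<eta> \<in> L2_forms orthant_metric p q" by (rule d(1))
  fix \<phi> :: "'a form" assume \<phi>: "\<phi> \<in> test_forms p (q + 1)"
  have "frame (codiff \<phi>) I J \<in> test_functions" for I J
    using codiff_test(1)[OF \<phi>] by (simp add: test_forms_iff frame_test)
  then have "form_inner orthant_metric (\<omega> - \<eta>) (codiff \<phi>)
      = form_inner orthant_metric \<omega> (codiff \<phi>) - form_inner orthant_metric \<eta> (codiff \<phi>)"
    using \<omega> \<eta> d(1)
    by (simp add: form_inner_test d(2) integrable_frame_test left_diff_distrib sum_subtractf)
  also have "\<dots> = 0"
    using assms \<phi> by (simp add: weak_dbar_def form_inner_zero dbar_adjoint_eq_codiff)
  finally show "form_inner orthant_metric 0 \<phi> = form_inner orthant_metric (\<omega> - \<eta>) (dbar_adjoint orthant_metric p q \<phi>)"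
    by (simp add: form_inner_zero dbar_adjoint_eq_codiff[OF \<phi>])
qed

lemma weak_dbar_0_0: "weak_dbar g p q 0 0"
  by (simp add: weak_dbar_def zero_L2_forms form_inner_zero)

theorem theorem4:
  fixes g :: "('n::{finite,linorder}) metric" and p :: nat and q :: int
  assumes "g = orthant_metric" and "1 \<le> p" and "0 \<le> q"
  shows "(\<forall>v \<in> L2_forms g p q. weak_dbar g p q v 0 \<longrightarrow>
            (\<exists>u \<in> L2_forms g p (q - 1). weak_dbar g p (q - 1) u v \<and>
               form_norm g u \<le> real p powr (- 1 / 2) * form_norm g v))
         \<and> L2_cohomology g p q = {L2_cohomology_zero g p q}"
proof
  have exact: "\<exists>u\<in>L2_forms g p (q - 1). weak_dbar g p (q - 1) u v
      \<and> form_norm g u \<le> real p powr (- 1 / 2) * form_norm g v" if v: "weak_dbar g p q v 0" for v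
  proof (intro bexI conjI)
    have v2: "v \<in> L2_forms orthant_metric p q" and cl: "weak_dbar orthant_metric p q v 0"
      using v assms(1) by (auto simp: weak_dbar_def)
    note u = primitive_properties[OF assms(2) v2]
    show "primitive v \<in> L2_forms g p (q - 1)" "weak_dbar g p (q - 1) (primitive v) v"
      using u(2) weak_dbar_primitive[OF assms(2) v2 cl] assms(1) by simp_all
    have "form_norm g (primitive v) \<le> sqrt (form_inner orthant_metric v v / p)"
      using u(3) assms(1) by (simp add: form_norm_def)
    also have "\<dots> = real p powr (- 1 / 2) * form_norm g v"
      using assms(2) by (simp add: form_norm_def assms(1) real_sqrt_divide powr_minus powr_half_sqrt field_simps)
    finally show "form_norm g (primitive v) \<le> real p powr (- 1 / 2) * form_norm g v" .
  qed
  then show "\<forall>v \<in> L2_forms g p q. weak_dbar g p q v 0 \<longrightarrow>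
      (\<exists>u \<in> L2_forms g p (q - 1). weak_dbar g p (q - 1) u v \<and>
         form_norm g u \<le> real p powr (- 1 / 2) * form_norm g v)"
    by blast
  \<comment> \<open>A closed form lies in the image itself, so it is its own approximation, with
    error \<open>form_norm g 0\<close>.\<close>
  have im: "\<omega> \<in> L2_closure g p q (dbar_im g p q)" if \<omega>: "weak_dbar g p q \<omega> 0" for \<omega>
  proof -
    obtain u where u: "u \<in> L2_forms g p (q - 1)" "weak_dbar g p (q - 1) u \<omega>"
      using exact[OF \<omega>] by blast
    then have "u \<in> dbar_domain g p (q - 1)" "\<omega> \<in> dbar_domain g p q"
      using \<omega> unfolding dbar_domain_def by (auto simp: weak_dbar_def[of g p q])
    then have "\<omega> \<in> dbar_im g p q"
      using u(2) unfolding dbar_im_def by blast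
    moreover have "form_norm g 0 = 0"
      by (simp add: form_norm_def form_inner_zero)
    moreover have "\<omega> \<in> L2_forms g p q" using \<omega> by (simp add: weak_dbar_def)
    ultimately show ?thesis
      unfolding L2_closure_def by (intro CollectI conjI allI impI bexI[of _ \<omega>]) simp_all
  qed
  have ker: "\<omega> \<in> dbar_ker g p q \<longleftrightarrow> weak_dbar g p q \<omega> 0" for \<omega>
    unfolding dbar_ker_def dbar_domain_def weak_dbar_def by blast
  have "\<omega> - \<eta> \<in> L2_closure g p q (dbar_im g p q)" if "\<omega> \<in> dbar_ker g p q" "\<eta> \<in> dbar_ker g p q" for \<omega> \<eta>
  proof (rule im)
    have "weak_dbar g p q \<omega> 0" "weak_dbar g p q \<eta> 0"
      using that by (simp_all only: ker)
    then show "weak_dbar g p q (\<omega> - \<eta>) 0"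
      unfolding assms(1) by (rule weak_dbar_0_diff)
  qed
  \<comment> \<open>All closed forms are equivalent, so there is at most one class; as 0 is closed,
    there is one, and it is the class of 0.\<close>
  then have "cohomologous g p q = dbar_ker g p q \<times> dbar_ker g p q"
    unfolding cohomologous_def by auto
  moreover have "0 \<in> dbar_ker g p q"
    by (simp add: ker weak_dbar_0_0)
  ultimately show "L2_cohomology g p q = {L2_cohomology_zero g p q}"
    unfolding L2_cohomology_def L2_cohomology_zero_def quotient_def by auto
qed

end
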